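(* Let $C>0$ be a given constant, let $0<\varepsilon_g<1/2$, and let $0<a_1<a_2$ be constants. Let $\xi_1,\dots,\xi_n$ be i.i.d. copies of a subgaussian random variable with mean zero and variance one. Assume $a_1N\le x\le a_2N$ and $x\le\sqrt n-N^{\varepsilon_g}$. Then for $\delta=N^{-C}$ and any open ball $B(a,\delta)\subset\mathbb R^2$, \[\mathbb P\Big(\tfrac1{\sqrt N}S_n(x,\xi)\in B(a,\delta)\Big)=O(\delta^2),\qquad S_n(x,\xi)=\sum_{i=1}^n\xi_i\big(b_i(x),c_i(x)\big).\]
   Context: $N$ is a large parameter with $N\le\sqrt n$ (in the paper $N=M$, the scale of the interval $[c_1M,c_2M]\subset[0,\sqrt n-M]$). For $x>0$, $b_i(x)=\sqrt N e^{-x^2/2}x^i/\sqrt{i!}$ and $c_i(x)=b_i'(x)=\sqrt N e^{-x^2/2}\frac{i-x^2}{x}\frac{x^i}{\sqrt{i!}}$; thus $S_n(x,\xi)/\sqrt N=(P_n(x),P_n'(x))$ with $P_n(x)=e^{-x^2/2}\sum_{i=1}^n\xi_ix^i/\sqrt{i!}$. Implied constants may depend on $C,\varepsilon_g,a_1,a_2$ and the law of $\xi$. *)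

theory Defs
  imports "HOL-Probability.Probability"
begin

definition subgaussian :: "real measure \<Rightarrow> bool" where
  "subgaussian D \<longleftrightarrow> (\<exists>K>0. \<forall>t\<ge>0. measure D {y \<in> space D. \<bar>y\<bar> \<ge> t} \<le> 2 * exp (- (t^2) / K^2))"

definition bfun :: "real \<Rightarrow> nat \<Rightarrow> real \<Rightarrow> real" where
  "bfun N i x = sqrt N * exp (- (x^2) / 2) * x ^ i / sqrt (fact i)"

text \<open>c_i(x) = b_i'(x) = sqrt N e^{-x^2/2} ((i - x^2)/x) x^i / sqrt(i!)\<close>
definition cfun :: "real \<Rightarrow> nat \<Rightarrow> real \<Rightarrow> real" where
  "cfun N i x = sqrt N * exp (- (x^2) / 2) * ((real i - x^2) / x) * x ^ i / sqrt (fact i)"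

definition Sn :: "real \<Rightarrow> nat \<Rightarrow> real \<Rightarrow> (nat \<Rightarrow> real) \<Rightarrow> real \<times> real" where
  "Sn N n x \<xi> = (\<Sum>i=1..n. (\<xi> i * bfun N i x, \<xi> i * cfun N i x))"

end

theory Submission
  imports Defs
begin

text \<open>
  By Gaussian smoothing, the probability is at most a constant times the mean of
  \<open>\<Prod>\<^sub>i \<bar>\<phi>(y\<^sub>i)\<bar>\<close>, where \<open>\<phi>\<close> is the characteristic function of the law,
  \<open>y\<^sub>i = w\<^sub>i (t + s (i - x\<^sup>2) / x)\<close> with \<open>w\<^sub>i = exp (- x\<^sup>2 / 2) x\<^sup>i / \<surd>(i!)\<close>, and \<open>(t, s)\<close> is
  \<open>1 / \<delta>\<close> times a standard Gaussian vector. Since two independent copies of the variable are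
  separated by a bounded nonzero amount with positive probability, it suffices to bound
  \<open>\<Sum>\<^sub>i (1 - cos y\<^sub>i)\<close> from below, and the window \<open>x\<^sup>2 - O(x) \<le> i \<le> x\<^sup>2\<close>, where \<open>w\<^sub>i\<close> has order
  \<open>1 / \<surd>x\<close>, is enough for that.

  For \<open>\<bar>t\<bar> + \<bar>s\<bar>\<close> up to a small multiple of \<open>\<surd>x\<close> all \<open>y\<^sub>i\<close> are at most 1 and the sum is of order
  \<open>t\<^sup>2 + s\<^sup>2\<close>. For \<open>\<bar>t\<bar> + \<bar>s\<bar>\<close> between that and any fixed power of \<open>x\<close> the sum is at least of order
  \<open>\<surd>x\<close>: every residue class modulo \<open>d \<approx> \<surd>x\<close> contains an \<open>i\<close> with \<open>y\<^sub>i\<close> far from \<open>2\<pi>\<int>\<close>.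
  Indeed, the \<open>k\<close>-th difference of \<open>y\<close> with step \<open>d\<close> is small for large \<open>k\<close>, so if \<open>y\<close> were close
  to \<open>2\<pi>\<int>\<close> along the class, then the nearest elements of \<open>2\<pi>\<int>\<close> would have vanishing \<open>k\<close>-th
  differences with step \<open>d\<close>, hence also with a step \<open>d h\<close> of order \<open>x\<close>. But a \<open>k\<close>-th difference of
  \<open>y\<close> with that step is not small: the Gaussian decay of \<open>w\<close> makes its top term dominant.
\<close>

section \<open>Iterated finite differences\<close>

text \<open>The step is an argument because unit steps, steps \<open>d\<close> near
  \<open>sqrt x\<close> and steps \<open>d * h\<close> of order \<open>x\<close> are
  compared.\<close>

definition fdiff :: "nat \<Rightarrow> (nat \<Rightarrow> real) \<Rightarrow> nat \<Rightarrow> real" where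
  "fdiff d f i = f (i + d) - f i"

lemma fdiff_commute: "fdiff d (fdiff e f) = fdiff e (fdiff d f)"
  by (auto simp: fdiff_def fun_eq_iff algebra_simps)

lemma fdiff_funpow_commute: "(fdiff d ^^ k) (fdiff e f) = fdiff e ((fdiff d ^^ k) f)"
  by (induction k) (simp_all add: fdiff_commute)

lemma fdiff_eq_sum: "fdiff d f i = (\<Sum>l<d. fdiff 1 f (i + l))"
  by (induction d) (simp_all add: fdiff_def)

lemma funpow_fdiff_add:
  "(fdiff d ^^ k) (\<lambda>i. f i + g i) = (\<lambda>i. (fdiff d ^^ k) f i + (fdiff d ^^ k) g i)"
  by (induction k) (auto simp: fdiff_def fun_eq_iff)

lemma funpow_fdiff_diff:
  "(fdiff d ^^ k) (\<lambda>i. f i - g i) = (\<lambda>i. (fdiff d ^^ k) f i - (fdiff d ^^ k) g i)"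
  by (induction k) (auto simp: fdiff_def fun_eq_iff)

lemma funpow_fdiff_cmult:
  "(fdiff d ^^ k) (\<lambda>i. c * f i) = (\<lambda>i. c * (fdiff d ^^ k) f i)"
  by (induction k) (auto simp: fdiff_def fun_eq_iff algebra_simps)

text \<open>Along a progression of step \<open>d\<close>, a step \<open>h\<close> of the parameter
  is a step \<open>d * h\<close> of the index. This moves estimates between a residue class and the
  full sequence; \<open>d = 1\<close> serves as a plain shift.\<close>

lemma funpow_fdiff_affine:
  "(fdiff h ^^ k) (\<lambda>l. f (i + d * l)) = (\<lambda>l. (fdiff (d * h) ^^ k) f (i + d * l))"
  by (induction k) (auto simp: fdiff_def fun_eq_iff algebra_simps)

text \<open>A difference of step \<open>d\<close> is a sum of \<open>d\<close> shifted unit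
  differences, so a \<open>k\<close>-fold one is a sum of \<open>d ^ k\<close> unit ones. The bound
  is only asked inside \<open>[lo, hi]\<close> because the estimates for the weights hold only in a
  window.\<close>

lemma abs_funpow_fdiff_le_step:
  assumes "\<And>i. i + k \<le> hi \<Longrightarrow> lo \<le> i \<Longrightarrow> \<bar>(fdiff 1 ^^ k) f i\<bar> \<le> M"
    and "lo \<le> i" "i + d * k \<le> hi"
  shows "\<bar>(fdiff d ^^ k) f i\<bar> \<le> real d ^ k * M"
  using assms
proof (induction k arbitrary: f i hi)
  case 0
  then show ?case by simp
next
  case (Suc k)
  \<comment> \<open>One outer difference is expanded and the resulting unit difference is moved into
    the function, which shortens the window by one; hence \<open>hi - 1\<close> below.\<close>
  have "(fdiff d ^^ Suc k) f i = (\<Sum>l<d. (fdiff d ^^ k) (fdiff 1 f) (i + l))"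
    by (simp add: fdiff_eq_sum[of d "(fdiff d ^^ k) f"] fdiff_funpow_commute)
  also have "\<bar>\<dots>\<bar> \<le> (\<Sum>l<d. \<bar>(fdiff d ^^ k) (fdiff 1 f) (i + l)\<bar>)"
    by (rule sum_abs)
  also have "\<dots> \<le> (\<Sum>l<d. real d ^ k * M)"
  proof (rule sum_mono)
    fix l assume "l \<in> {..<d}"
    then show "\<bar>(fdiff d ^^ k) (fdiff 1 f) (i + l)\<bar> \<le> real d ^ k * M"
      using Suc.prems
      by (intro Suc.IH[where hi = "hi - 1"])
        (auto simp: fdiff_funpow_commute)
  qed
  finally show ?case by (simp add: algebra_simps)
qed

text \<open>The binomial coefficients of a \<open>k\<close>-fold difference add up to
  \<open>2 ^ k\<close> in absolute value.\<close>

lemma abs_funpow_fdiff_le: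
  assumes "\<And>j. j \<le> k \<Longrightarrow> \<bar>f (i + d * j)\<bar> \<le> B"
  shows "\<bar>(fdiff d ^^ k) f i\<bar> \<le> 2 ^ k * B"
  using assms
proof (induction k arbitrary: i)
  case 0
  from "0"[of 0] show ?case by simp
next
  case (Suc k)
  have "\<bar>(fdiff d ^^ k) f (i + d)\<bar> \<le> 2 ^ k * B"
    using Suc.prems[of "Suc _"] by (intro Suc.IH) (simp add: algebra_simps)
  moreover have "\<bar>(fdiff d ^^ k) f i\<bar> \<le> 2 ^ k * B"
    using Suc.prems by (intro Suc.IH) simp
  ultimately show ?case by (simp add: fdiff_def[of d "(fdiff d ^^ k) f"])
qed

text \<open>The top value enters with coefficient 1 and the other coefficients add up to less than
  \<open>2 ^ k\<close>. This isolates the top term when it dominates.\<close>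

lemma abs_funpow_fdiff_minus_top_le:
  assumes "\<And>j. j < k \<Longrightarrow> \<bar>f (i + d * j)\<bar> \<le> B" "0 \<le> B"
  shows "\<bar>(fdiff d ^^ k) f i - f (i + d * k)\<bar> \<le> 2 ^ k * B"
  using assms
proof (induction k arbitrary: i)
  case 0
  then show ?case by simp
next
  case (Suc k)
  have "\<bar>(fdiff d ^^ k) f (i + d) - f (i + d + d * k)\<bar> \<le> 2 ^ k * B"
    using Suc.prems(1)[of "Suc _"] Suc.prems(2) by (intro Suc.IH) (simp_all add: algebra_simps)
  moreover have "\<bar>(fdiff d ^^ k) f i\<bar> \<le> 2 ^ k * B"
    using Suc.prems by (intro abs_funpow_fdiff_le) simp
  ultimately show ?case
    by (simp add: fdiff_def[of d "(fdiff d ^^ k) f"] algebra_simps)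
qed

lemma funpow_fdiff_Ints: "(\<And>i. f i \<in> \<int>) \<Longrightarrow> (fdiff d ^^ k) f i \<in> \<int>"
  by (induction k arbitrary: i) (auto simp: fdiff_def)

text \<open>The nearest multiples of \<open>2\<pi>\<close> form a sequence with vanishing \<open>k\<close>-th differences of
  step 1, hence also of step \<open>h\<close>.\<close>
lemma funpow_fdiff_le_of_near_2pi_Ints:
  fixes f :: "nat \<Rightarrow> real"
  assumes near: "\<And>l. l \<le> h * k \<Longrightarrow> \<exists>p::int. \<bar>f l - 2 * pi * p\<bar> \<le> \<eta>"
    and small: "\<And>l. l + k \<le> h * k \<Longrightarrow> \<bar>(fdiff 1 ^^ k) f l\<bar> \<le> 1"
    and \<eta>: "2 ^ k * \<eta> \<le> 1"
  shows "\<bar>(fdiff h ^^ k) f 0\<bar> \<le> 2 ^ k * \<eta>"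
proof -
  obtain q :: "nat \<Rightarrow> int" where q: "\<And>l. l \<le> h * k \<Longrightarrow> \<bar>f l - 2 * pi * q l\<bar> \<le> \<eta>"
    using near by metis
  define p where "p l = real_of_int (q l)" for l
  define e where "e l = f l - 2 * pi * p l" for l
  have e: "\<bar>e l\<bar> \<le> \<eta>" if "l \<le> h * k" for l
    using q[OF that] by (simp add: e_def p_def)
  have fe: "(fdiff m ^^ k) e l = (fdiff m ^^ k) f l - 2 * pi * (fdiff m ^^ k) p l" for m l
    unfolding e_def by (simp add: funpow_fdiff_diff funpow_fdiff_cmult)
  have p0: "(fdiff 1 ^^ k) p l = 0" if l: "l + k \<le> h * k" for l
  proof -
    have "\<bar>(fdiff 1 ^^ k) e l\<bar> \<le> 2 ^ k * \<eta>"
      using l by (intro abs_funpow_fdiff_le e) auto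
    \<comment> \<open>Both \<open>f\<close> and the error \<open>e\<close> have \<open>k\<close>-th
      differences at most 1, so the integer difference of \<open>p\<close> is at most
      \<open>2 / (2 * pi)\<close> in absolute value and must vanish.\<close>
    with small[OF l] \<eta> have "2 * pi * \<bar>(fdiff 1 ^^ k) p l\<bar> \<le> 2"
      unfolding fe by (simp add: abs_mult[symmetric])
    also have "2 < 2 * pi" using pi_gt3 by simp
    finally have "\<bar>(fdiff 1 ^^ k) p l\<bar> < 1" by simp
    moreover have "(fdiff 1 ^^ k) p l \<in> \<int>"
      by (rule funpow_fdiff_Ints) (simp add: p_def)
    ultimately show ?thesis
      by (metis Ints_nonzero_abs_less1)
  qed
  \<comment> \<open>A difference of step \<open>h\<close> is a sum of unit differences, all of them
    0 here, so \<open>f\<close> and \<open>e\<close> share it.\<close>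
  have "\<bar>(fdiff h ^^ k) p 0\<bar> \<le> real h ^ k * 0"
    by (rule abs_funpow_fdiff_le_step[where lo = 0 and hi = "h * k"]) (use p0 in auto)
  then have "(fdiff h ^^ k) f 0 = (fdiff h ^^ k) e 0"
    by (simp add: fe)
  also have "\<bar>\<dots>\<bar> \<le> 2 ^ k * \<eta>"
    by (intro abs_funpow_fdiff_le e) auto
  finally show ?thesis .
qed

section \<open>Differences of products and of smooth functions\<close>

text \<open>By the discrete Leibniz rule each of the \<open>a\<close> differences falls on one of
  the factors, giving \<open>2 ^ a\<close> terms of size \<open>B * B' * r ^ a\<close>.\<close>

lemma abs_funpow_fdiff_mult_le:
  fixes f g :: "nat \<Rightarrow> real"
  assumes "\<And>j i. j \<le> a \<Longrightarrow> lo \<le> i \<Longrightarrow> i + j \<le> hi \<Longrightarrow> \<bar>(fdiff 1 ^^ j) f i\<bar> \<le> B * r ^ j"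
    and "\<And>j i. j \<le> a \<Longrightarrow> lo \<le> i \<Longrightarrow> i + j \<le> hi \<Longrightarrow> \<bar>(fdiff 1 ^^ j) g i\<bar> \<le> B' * r ^ j"
    and "0 \<le> r" "0 \<le> B" "0 \<le> B'" "lo \<le> i" "i + a \<le> hi"
  shows "\<bar>(fdiff 1 ^^ a) (\<lambda>i. f i * g i) i\<bar> \<le> 2 ^ a * B * B' * r ^ a"
  using assms
proof (induction a arbitrary: f g B B' i hi)
  case 0
  from "0.prems"(1)[of 0 i] "0.prems"(2)[of 0 i] "0.prems"(3-) show ?case
    by (auto simp: abs_mult intro!: mult_mono)
next
  case (Suc a)
  let ?D = "fdiff 1" and ?g = "\<lambda>i. g (i + 1)"
  have g': "(?D ^^ j) ?g = (\<lambda>i. (?D ^^ j) g (i + 1))" for j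
    by (induction j) (auto simp: fdiff_def fun_eq_iff)
  \<comment> \<open>The product rule, with \<open>g\<close> shifted in the first summand. In either
    summand one factor has been differenced, which turns its constant \<open>B\<close> into
    \<open>B * r\<close>, or \<open>B'\<close> into \<open>B' * r\<close>, for the induction
    hypothesis.\<close>
  have eq: "?D (\<lambda>i. f i * g i) = (\<lambda>i. ?D f i * ?g i + f i * ?D g i)"
    by (auto simp: fdiff_def fun_eq_iff algebra_simps)
  have "\<bar>(?D ^^ a) (\<lambda>i. ?D f i * ?g i) i\<bar> \<le> 2 ^ a * (B * r) * B' * r ^ a"
  proof (rule Suc.IH[where hi = "hi - 1"])
    fix j i assume "j \<le> a" "lo \<le> i" "i + j \<le> hi - 1"
    with Suc.prems(7) have ij: "Suc j \<le> Suc a" "lo \<le> i" "i + Suc j \<le> hi" "j \<le> Suc a" "lo \<le> i + 1" "i + 1 + j \<le> hi"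
      by linarith+
    show "\<bar>(?D ^^ j) (?D f) i\<bar> \<le> B * r * r ^ j"
      using Suc.prems(1)[OF ij(1-3)] by (simp add: funpow_Suc_right mult.assoc del: funpow.simps)
    show "\<bar>(?D ^^ j) ?g i\<bar> \<le> B' * r ^ j"
      unfolding g' by (rule Suc.prems(2)[OF ij(4-6)])
  qed (use Suc.prems in auto)
  moreover have "\<bar>(?D ^^ a) (\<lambda>i. f i * ?D g i) i\<bar> \<le> 2 ^ a * B * (B' * r) * r ^ a"
  proof (rule Suc.IH[where hi = "hi - 1"])
    fix j i assume "j \<le> a" "lo \<le> i" "i + j \<le> hi - 1"
    with Suc.prems(7) have ij: "Suc j \<le> Suc a" "lo \<le> i" "i + Suc j \<le> hi" "j \<le> Suc a" "i + j \<le> hi"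
      by linarith+
    show "\<bar>(?D ^^ j) f i\<bar> \<le> B * r ^ j"
      by (rule Suc.prems(1)[OF ij(4,2,5)])
    show "\<bar>(?D ^^ j) (?D g) i\<bar> \<le> B' * r * r ^ j"
      using Suc.prems(2)[OF ij(1-3)] by (simp add: funpow_Suc_right mult.assoc del: funpow.simps)
  qed (use Suc.prems in auto)
  moreover have "(?D ^^ Suc a) (\<lambda>i. f i * g i) i
      = (?D ^^ a) (\<lambda>i. ?D f i * ?g i) i + (?D ^^ a) (\<lambda>i. f i * ?D g i) i"
    by (simp only: funpow_Suc_right o_def eq funpow_fdiff_add)
  ultimately show ?case by (simp add: algebra_simps)
qed

text \<open>\<open>F j\<close> stands for the \<open>j\<close>-th derivative of \<open>F 0\<close>.
  The unit differences \<open>F j (u + 1) - F j u\<close> again form a chain of derivatives, and the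
  mean value theorem bounds them by the derivative one order higher.\<close>

lemma abs_funpow_fdiff_le_deriv:
  fixes F :: "nat \<Rightarrow> real \<Rightarrow> real"
  assumes "\<And>j u. u \<ge> v \<Longrightarrow> (F j has_real_derivative F (Suc j) u) (at u)"
    and "\<And>u. u \<ge> v \<Longrightarrow> \<bar>F (m + a) u\<bar> \<le> M" and "v \<le> u"
  shows "\<bar>(fdiff 1 ^^ a) (\<lambda>l. F m (u + real l)) 0\<bar> \<le> M"
  using assms
proof (induction a arbitrary: F)
  case 0
  then show ?case by simp
next
  case (Suc a)
  let ?F = "\<lambda>j u. F j (u + 1) - F j u"
  have "\<bar>(fdiff 1 ^^ a) (\<lambda>l. ?F m (u + real l)) 0\<bar> \<le> M"
  proof (rule Suc.IH)
    fix j u assume "u \<ge> v"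
    then show "(?F j has_real_derivative ?F (Suc j) u) (at u)"
      using DERIV_shift[of "F j" "F (Suc j) (u + 1)" u 1]
      by (auto intro!: DERIV_diff Suc.prems(1))
  next
    fix u assume u: "u \<ge> v"
    have "\<exists>z>u. z < u + 1 \<and> F (m + a) (u + 1) - F (m + a) u = (u + 1 - u) * F (Suc (m + a)) z"
      using u by (intro MVT2 Suc.prems(1)) auto
    then show "\<bar>?F (m + a) u\<bar> \<le> M"
      using Suc.prems(2) u by auto
  qed fact
  moreover have "fdiff 1 (\<lambda>l. F m (u + real l)) = (\<lambda>l. ?F m (u + real l))"
    by (auto simp: fdiff_def fun_eq_iff add_ac)
  ultimately show ?case by (simp only: funpow_Suc_right o_def)
qed

section \<open>The weights\<close>

text \<open>The square of \<open>wt x i\<close> is the probability of \<open>i\<close> under the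
  Poisson law of mean \<open>x^2\<close>; \<open>bfun N i x\<close> is
  \<open>sqrt N * wt x i\<close>.\<close>

definition wt :: "real \<Rightarrow> nat \<Rightarrow> real" where
  "wt x i = exp (- (x^2) / 2) * x ^ i / sqrt (fact i)"

lemma wt_pos: "0 < x \<Longrightarrow> 0 < wt x i"
  by (simp add: wt_def)

lemma wt_Suc: "wt x (Suc i) = wt x i * (x / sqrt (real (Suc i)))"
  by (simp add: wt_def real_sqrt_mult mult_ac del: of_nat_Suc)

lemma wt_pred: "0 < x \<Longrightarrow> wt x i = wt x (Suc i) * (sqrt (real (Suc i)) / x)"
  by (simp add: wt_Suc)

lemma wt_sq: "(wt x i)\<^sup>2 = exp (- x\<^sup>2) * ((x\<^sup>2) ^ i / fact i)"
proof -
  have "(exp (- (x^2) / 2))\<^sup>2 = exp (- x\<^sup>2)"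
    by (simp add: exp_double[symmetric])
  then show ?thesis
    by (simp add: wt_def power_mult_distrib power_divide power_mult[symmetric] mult.commute)
qed

text \<open>Poisson probabilities have total mass 1.\<close>

lemma sum_wt_sq_le: "finite A \<Longrightarrow> (\<Sum>i\<in>A. (wt x i)\<^sup>2) \<le> 1"
proof -
  assume A: "finite A"
  have "(\<Sum>i\<in>A. (x\<^sup>2) ^ i / fact i) \<le> exp (x\<^sup>2)"
    using sum_le_suminf[OF summable_exp[of "x\<^sup>2"] A]
    by (simp add: exp_def divide_inverse mult.commute)
  then have "exp (- x\<^sup>2) * (\<Sum>i\<in>A. (x\<^sup>2) ^ i / fact i) \<le> exp (- x\<^sup>2) * exp (x\<^sup>2)"
    by (intro mult_left_mono) auto
  then show ?thesis by (simp add: wt_sq sum_distrib_left exp_minus)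
qed

lemma wt_le_1: "wt x i \<le> 1"
  using sum_wt_sq_le[of "{i}" x] by (simp add: power_le_one_iff abs_square_le_1)

text \<open>Going from \<open>i - m\<close> to the index below multiplies the weight by
  \<open>sqrt ((i - m) / x^2)\<close>, at most \<open>exp (- m / (2 * x^2))\<close>. The exponents
  add up to a quadratic in \<open>m\<close>, the Gaussian decay of the overview.\<close>

lemma wt_decay:
  assumes "0 < x" "real i \<le> x\<^sup>2" "m \<le> i"
  shows "wt x (i - m) \<le> exp (- (real m * (real m - 1) / (4 * x\<^sup>2))) * wt x i"
  using assms(3)
proof (induction m)
  case 0
  then show ?case by simp
next
  case (Suc m)
  define j where "j = i - Suc m"
  have j: "i - m = Suc j" "real (Suc j) = real i - real m"
    using Suc.prems by (auto simp: j_def of_nat_diff)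
  have "(sqrt (real (Suc j)) / x)\<^sup>2 = (real i - real m) / x\<^sup>2"
    unfolding power_divide using j(2) by simp
  also have "\<dots> \<le> 1 - real m / x\<^sup>2"
    using assms by (simp add: field_simps)
  also have "\<dots> \<le> exp (- (real m / x\<^sup>2))"
    using exp_ge_add_one_self[of "- (real m / x\<^sup>2)"] by simp
  also have "\<dots> = (exp (- (real m / (2 * x\<^sup>2))))\<^sup>2"
    by (simp add: exp_double[symmetric])
  finally have q: "sqrt (real (Suc j)) / x \<le> exp (- (real m / (2 * x\<^sup>2)))"
    by (rule power2_le_imp_le) simp
  have "wt x j = wt x (Suc j) * (sqrt (real (Suc j)) / x)"
    using assms by (intro wt_pred)
  also have "\<dots> \<le> (exp (- (real m * (real m - 1) / (4 * x\<^sup>2))) * wt x i)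
      * exp (- (real m / (2 * x\<^sup>2)))"
    using Suc.IH Suc.prems q wt_pos[OF assms(1)] assms(1) unfolding j(1)
    by (intro mult_mono) (auto intro: less_imp_le)
  also have "\<dots> = exp (- (real m * (real m - 1) / (4 * x\<^sup>2)) + - (real m / (2 * x\<^sup>2))) * wt x i"
    by (simp only: exp_add mult_ac)
  also have "- (real m * (real m - 1) / (4 * x\<^sup>2)) + - (real m / (2 * x\<^sup>2))
      = - (real (Suc m) * (real (Suc m) - 1) / (4 * x\<^sup>2))"
    using assms by (simp add: field_simps)
  finally show ?case by (simp add: j_def)
qed

lemma wt_mono:
  assumes "0 < x" "real i \<le> x\<^sup>2" "j \<le> i"
  shows "wt x j \<le> wt x i"
proof -
  have "wt x (i - (i - j)) \<le> exp (- (real (i - j) * (real (i - j) - 1) / (4 * x\<^sup>2))) * wt x i"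
    using assms by (intro wt_decay) auto
  also have "\<dots> \<le> 1 * wt x i"
  proof (rule mult_right_mono)
    have "0 \<le> real (i - j) * (real (i - j) - 1)"
      by (cases "i - j") auto
    then show "exp (- (real (i - j) * (real (i - j) - 1) / (4 * x\<^sup>2))) \<le> 1" by simp
  qed (use wt_pos[OF assms(1)] in \<open>auto intro: less_imp_le\<close>)
  finally show ?thesis using assms(3) by simp
qed

section \<open>Size of the weights just below \<open>x^2\<close>\<close>

text \<open>Stirling's upper bound with constant \<open>e\<close>, an equality at
  \<open>n = 1\<close>. In logarithms, the induction step is
  \<open>ln (1 + 1 / n) >= 2 / (2 * n + 1)\<close>.\<close>

lemma fact_le_Stirling:
  assumes "n \<ge> 1"
  shows "fact n \<le> exp 1 * sqrt (real n) * (real n / exp 1) ^ n"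
proof -
  have "ln (fact n :: real) \<le> 1 + ln (real n) / 2 + real n * ln (real n) - real n"
    using assms
  proof (induction n rule: nat_induct_at_least)
    case base
    then show ?case by simp
  next
    case (Suc n)
    have "2 * (real (Suc n) - real n) / (real n + real (Suc n)) \<le> ln (real (Suc n)) - ln (real n)"
      using Suc.hyps by (intro ln_inverse_approx_ge) auto
    then have "1 \<le> (real n + 1 / 2) * (ln (real (Suc n)) - ln (real n))"
      by (simp add: field_simps)
    moreover have "ln (fact (Suc n) :: real) = ln (real (Suc n)) + ln (fact n)"
      unfolding fact_Suc of_nat_mult by (subst ln_mult) auto
    ultimately show ?case using Suc.IH by (simp add: algebra_simps)
  qed
  also have "\<dots> = ln (exp 1 * sqrt (real n) * (real n / exp 1) ^ n)"
    using assms by (simp add: ln_mult ln_div ln_realpow ln_sqrt algebra_simps)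
  finally show ?thesis using assms by (subst (asm) ln_le_cancel_iff) auto
qed

text \<open>Stirling's bound at the mode of the Poisson law. One factor \<open>exp (- 1)\<close>
  comes from the Stirling constant, the other from rounding \<open>x^2\<close> down.\<close>

lemma wt_sq_floor_ge:
  assumes "x \<ge> 1"
  shows "exp (- 2) / x \<le> (wt x (nat \<lfloor>x\<^sup>2\<rfloor>))\<^sup>2"
proof -
  define m where "m = nat \<lfloor>x\<^sup>2\<rfloor>"
  have x2: "1 \<le> x\<^sup>2" using assms by (simp add: one_le_power)
  then have m: "real m \<le> x\<^sup>2" "x\<^sup>2 \<le> real m + 1" "1 \<le> m"
    unfolding m_def by linarith+
  have "fact m \<le> exp 1 * sqrt (real m) * (real m / exp 1) ^ m"
    using m(3) by (rule fact_le_Stirling)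
  also have "\<dots> \<le> exp 1 * x * (exp (- real m) * (x\<^sup>2) ^ m)"
  proof -
    have "sqrt (real m) \<le> x" using m(1) assms by (simp add: real_le_lsqrt)
    moreover have "(real m / exp 1) ^ m = exp (- real m) * real m ^ m"
      by (simp add: power_divide exp_minus field_simps exp_of_nat_mult[symmetric])
    moreover have "real m ^ m \<le> (x\<^sup>2) ^ m" using m by (intro power_mono) auto
    ultimately show ?thesis using assms
      by (auto intro!: mult_mono)
  qed
  finally have f: "fact m \<le> exp 1 * x * (exp (- real m) * (x\<^sup>2) ^ m)" .
  have "exp (- 2) / x * fact m \<le> exp (-2) / x * (exp 1 * x * (exp (- real m) * (x\<^sup>2) ^ m))"
    using f assms by (intro mult_left_mono) auto
  also have "\<dots> = (exp (- 2) * exp 1 * exp (- real m)) * (x\<^sup>2) ^ m"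
    using assms by simp
  also have "exp (- 2) * exp 1 * exp (- real m) = exp (- (real m + 1))"
    by (simp add: exp_add[symmetric])
  also have "exp (- (real m + 1)) * (x\<^sup>2) ^ m \<le> exp (- x\<^sup>2) * (x\<^sup>2) ^ m"
    using m(2) by (intro mult_right_mono) auto
  finally show ?thesis
    unfolding m_def[symmetric] wt_sq by (simp add: field_simps)
qed

text \<open>Each step down multiplies the squared weight by at least \<open>1 - 2 / x\<close>, and
  there are at most \<open>2 * x\<close> steps.\<close>

lemma wt_sq_ge_near_floor:
  assumes x: "x \<ge> 4" and m: "x\<^sup>2 - 2 * x \<le> real (nat \<lfloor>x\<^sup>2\<rfloor>) - real m"
  shows "exp (- 8) * (wt x (nat \<lfloor>x\<^sup>2\<rfloor>))\<^sup>2 \<le> (wt x (nat \<lfloor>x\<^sup>2\<rfloor> - m))\<^sup>2"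
proof -
  define \<mu> where "\<mu> = nat \<lfloor>x\<^sup>2\<rfloor>"
  have \<mu>: "real \<mu> \<le> x\<^sup>2" unfolding \<mu>_def by simp
  have "(1 - 2 / x) ^ m * (wt x \<mu>)\<^sup>2 \<le> (wt x (\<mu> - m))\<^sup>2"
    using m unfolding \<mu>_def[symmetric]
  proof (induction m)
    case 0
    then show ?case by simp
  next
    case (Suc m)
    define j where "j = \<mu> - Suc m"
    have "0 \<le> x\<^sup>2 - 2 * x" using x by (simp add: power2_eq_square)
    with Suc.prems have "Suc m \<le> \<mu>" by linarith
    then have j: "\<mu> - m = Suc j" "real j = real \<mu> - real (Suc m)"
      by (auto simp: j_def of_nat_diff)
    have "1 - 2 / x \<le> (sqrt (real (Suc j)) / x)\<^sup>2"
    proof -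
      have "(1 - 2 / x) * x\<^sup>2 = x\<^sup>2 - 2 * x" using x by (simp add: field_simps power2_eq_square)
      also have "\<dots> \<le> real (Suc j)" using Suc.prems j(2) by simp
      finally show ?thesis using x by (simp add: power_divide field_simps)
    qed
    then have "((1 - 2 / x) ^ m * (wt x \<mu>)\<^sup>2) * (1 - 2 / x)
        \<le> (wt x (\<mu> - m))\<^sup>2 * (sqrt (real (Suc j)) / x)\<^sup>2"
      using Suc.IH Suc.prems x by (intro mult_mono) auto
    also have "\<dots> = (wt x j)\<^sup>2"
      unfolding j(1) power_mult_distrib[symmetric] using x by (subst (2) wt_pred) auto
    finally show ?case by (simp add: j_def mult_ac)
  qed
  moreover have "exp (- 8) \<le> (1 - 2 / x) ^ m"
  proof -
    define u where "u = 2 / x"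
    have u: "0 \<le> u" "u \<le> 1 / 2" using x by (auto simp: u_def field_simps)
    \<comment> \<open>This gives \<open>1 - u >= exp (- 2 * u)\<close> for
      \<open>0 <= u <= 1 / 2\<close>; with \<open>m <= 2 * x\<close> the total exponent is at most
      8.\<close>
    have "(1 + 2 * u) * (1 - u) = 1 + u * (1 - 2 * u)" by (simp add: algebra_simps)
    then have "1 \<le> (1 + 2 * u) * (1 - u)" using u by simp
    also have "\<dots> \<le> exp (2 * u) * (1 - u)"
      using u exp_ge_add_one_self[of "2 * u"] by (intro mult_right_mono) auto
    finally have "exp (- (2 * u)) \<le> 1 - u" by (simp add: exp_minus field_simps)
    then have "exp (- (2 * u)) ^ m \<le> (1 - u) ^ m" by (intro power_mono) auto
    moreover have "real m \<le> 2 * x" using m \<mu> unfolding \<mu>_def by linarith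
    then have "real m * (2 * u) \<le> 8"
      using x by (simp add: u_def field_simps)
    then have "exp (- 8) \<le> exp (- (2 * u)) ^ m"
      by (simp add: exp_of_nat_mult[symmetric])
    ultimately show ?thesis by (simp add: u_def)
  qed
  ultimately show ?thesis
    unfolding \<mu>_def[symmetric]
    by (meson dual_order.trans mult_right_mono zero_le_power2)
qed

text \<open>The lower bound chains the two preceding lemmas. For the upper bound, at least
  \<open>x\<close> indices from the mode downwards carry squared weight comparable to that of the
  mode, while the total mass is at most 1; monotonicity extends the bound to all
  \<open>i\<close>.\<close>

lemma wt_bounds:
  assumes x: "x \<ge> 4" and i: "x\<^sup>2 - 2 * x \<le> real i" "real i \<le> x\<^sup>2"
  shows "exp (- 5) / sqrt x \<le> wt x i" "wt x i \<le> exp 4 / sqrt x"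
proof -
  define \<mu> where "\<mu> = nat \<lfloor>x\<^sup>2\<rfloor>"
  have \<mu>: "real \<mu> \<le> x\<^sup>2" "x\<^sup>2 - 1 \<le> real \<mu>" unfolding \<mu>_def by (simp, linarith)
  have i\<mu>: "i \<le> \<mu>" using i(2) unfolding \<mu>_def by linarith
  have "exp (- 8) * (exp (- 2) / x) \<le> exp (- 8) * (wt x \<mu>)\<^sup>2"
    using wt_sq_floor_ge[of x] x unfolding \<mu>_def by (intro mult_left_mono) auto
  also have "\<dots> \<le> (wt x (\<mu> - (\<mu> - i)))\<^sup>2"
    unfolding \<mu>_def
    by (rule wt_sq_ge_near_floor[OF x]) (use i\<mu> i in \<open>simp add: \<mu>_def[symmetric] of_nat_diff\<close>)
  finally have "exp (- 8) * (exp (- 2) / x) \<le> (wt x i)\<^sup>2" using i\<mu> by simp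
  moreover have "(exp (- 5) / sqrt x)\<^sup>2 = exp (- 8) * (exp (- 2) / x)"
    using x by (simp add: power_divide exp_double[symmetric] exp_add[symmetric])
  ultimately show "exp (- 5) / sqrt x \<le> wt x i"
    by (intro power2_le_imp_le[OF _ less_imp_le[OF wt_pos]]) (use x in auto)
  define m where "m = nat \<lfloor>x\<rfloor>"
  have m: "real m \<le> x" "x \<le> real (m + 1)" using x unfolding m_def by linarith+
  have 4: "4 * x \<le> x\<^sup>2" using x by (simp add: power2_eq_square)
  have m\<mu>: "m \<le> \<mu>" using 4 m \<mu> x by linarith
  have "x * (exp (- 8) * (wt x \<mu>)\<^sup>2) \<le> (\<Sum>j\<le>m. exp (- 8) * (wt x \<mu>)\<^sup>2)"
    using m by (simp add: mult_right_mono)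
  also have "\<dots> \<le> (\<Sum>j\<le>m. (wt x (\<mu> - j))\<^sup>2)"
  proof (rule sum_mono)
    fix j assume "j \<in> {..m}"
    then have "x\<^sup>2 - 2 * x \<le> real \<mu> - real j"
      using m(1) \<mu>(2) x by auto
    then show "exp (- 8) * (wt x \<mu>)\<^sup>2 \<le> (wt x (\<mu> - j))\<^sup>2"
      unfolding \<mu>_def by (rule wt_sq_ge_near_floor[OF x])
  qed
  also have "\<dots> = (\<Sum>i\<in>(\<lambda>j. \<mu> - j) ` {..m}. (wt x i)\<^sup>2)"
    using m\<mu> by (subst sum.reindex) (auto simp: inj_on_def)
  also have "\<dots> \<le> 1" by (rule sum_wt_sq_le) simp
  finally have "(wt x \<mu>)\<^sup>2 \<le> exp 8 / x"
    using x by (simp add: exp_minus field_simps)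
  also have "\<dots> = (exp 4 / sqrt x)\<^sup>2"
    using x by (simp add: power_divide exp_double[symmetric])
  finally have "wt x \<mu> \<le> exp 4 / sqrt x"
    by (rule power2_le_imp_le) (use x in auto)
  moreover have "wt x i \<le> wt x \<mu>"
    using \<mu> i\<mu> x by (intro wt_mono) auto
  ultimately show "wt x i \<le> exp 4 / sqrt x" by simp
qed

section \<open>Finite differences of the weights\<close>

text \<open>The quantity differenced is the relative increment of \<open>wt x\<close>. For
  \<open>j = 0\<close> it is \<open>O(1 / x)\<close> because \<open>i\<close> is within
  \<open>K * x\<close> of \<open>x^2\<close>. For \<open>j >= 1\<close> the constant 1 drops out,
  and the \<open>j\<close>-th derivative of \<open>u powr (- 1 / 2)\<close> at \<open>u\<close> of
  order \<open>x^2\<close> gives \<open>x * x powr (- 2 * j - 1)\<close>, which suffices since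
  \<open>2 * j >= j + 1\<close>.\<close>

lemma fdiff_wt_ratio_bound:
  fixes K :: real and j :: nat
  assumes "0 \<le> K"
  shows "\<exists>B\<ge>0. \<forall>x\<ge>2 * K + 2. \<forall>i. x\<^sup>2 - K * x \<le> real i \<and> real i + 1 + real j \<le> x\<^sup>2 \<longrightarrow>
     \<bar>(fdiff 1 ^^ j) (\<lambda>i. x / sqrt (real (Suc i)) - 1) i\<bar> \<le> B / x * (1 / x) ^ j"
proof (cases j)
  case 0
  have "\<bar>x / sqrt (real (Suc i)) - 1\<bar> \<le> 2 * K / x"
    if x: "x \<ge> 2 * K + 2" and i: "x\<^sup>2 - K * x \<le> real i" "real i + 1 \<le> x\<^sup>2" for x i
  proof -
    define r where "r = sqrt (real (Suc i))"
    have x0: "x > 0" "2 \<le> x" using x assms by auto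
    have r2: "r\<^sup>2 = real i + 1" by (simp add: r_def)
    have rx: "r \<le> x" using i(2) x0 unfolding r_def by (intro real_le_lsqrt) auto
    \<comment> \<open>The threshold \<open>2 * K + 2\<close> keeps the window above
      \<open>(x / 2)^2\<close>.\<close>
    have "K * x \<le> (x / 2) * x" using x x0 by (intro mult_right_mono) auto
    then have "(x / 2)\<^sup>2 \<le> real (Suc i)"
      using i(1) zero_le_power2[of x] by (simp add: power2_eq_square)
    then have rx2: "x / 2 \<le> r" unfolding r_def by (rule real_le_rsqrt)
    then have r0: "r > 0" using x0 by simp
    have "(x - r) * x \<le> (x - r) * (x + r)" using r0 rx by (intro mult_left_mono) auto
    also have "\<dots> = x\<^sup>2 - r\<^sup>2" by (simp add: algebra_simps power2_eq_square)
    also have "\<dots> \<le> K * x" using i r2 by simp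
    finally have "x - r \<le> K" using x0 by simp
    have "x / r - 1 = (x - r) / r" using r0 by (simp add: field_simps)
    also have "\<dots> \<le> K / (x / 2)" using \<open>x - r \<le> K\<close> rx2 x0 assms by (intro frac_le) auto
    finally show ?thesis unfolding r_def[symmetric]
      using rx r0 by (simp add: field_simps)
  qed
  then show ?thesis using assms 0
    by (intro exI[of _ "2 * K"]) auto
next
  case (Suc j')
  \<comment> \<open>\<open>F j\<close> will be the \<open>j\<close>-th derivative of
    \<open>1 / sqrt u\<close>, with \<open>c j\<close> the product of the exponents brought
    down.\<close>
  define c where "c j = (\<Prod>l<j. - (1 / 2) - real l)" for j :: nat
  define F where "F j u = c j * u powr (- (1 / 2) - real j)" for j u
  define B where "B = \<bar>c j\<bar> * (2 ^ (2 * j + 1))"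
  have "\<bar>(fdiff 1 ^^ j) (\<lambda>i. x / sqrt (real (Suc i)) - 1) i\<bar> \<le> B / x * (1 / x) ^ j"
    if x: "x \<ge> 2 * K + 2" and i: "x\<^sup>2 - K * x \<le> real i" for x i
  proof -
    have x0: "x > 0" "1 \<le> x" using x assms by auto
    have F_eq: "F 0 u = 1 / sqrt u" if "u > 0" for u
    proof -
      have "u powr (- (1 / 2)) = inverse (sqrt u)"
        by (subst powr_minus, subst powr_half_sqrt) (use that in auto)
      then show ?thesis by (simp add: F_def c_def inverse_eq_divide)
    qed
    have "(fdiff 1 ^^ m) (\<lambda>i. 0) = (\<lambda>i. 0)" for m
      by (induction m) (simp_all add: fdiff_def)
    moreover have "fdiff 1 (\<lambda>i. 1) = (\<lambda>i. 0)" by (simp add: fun_eq_iff fdiff_def)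
    ultimately have D0: "(fdiff 1 ^^ j) (\<lambda>i. 1) = (\<lambda>i. 0)"
      unfolding Suc funpow_Suc_right o_def by simp
    have "(fdiff 1 ^^ j) (\<lambda>i. x / sqrt (real (Suc i)) - 1) i
        = (fdiff 1 ^^ j) (\<lambda>i. x * (1 / sqrt (real (Suc i)))) i"
      by (simp only: funpow_fdiff_diff D0) simp
    also have "\<dots> = x * (fdiff 1 ^^ j) (\<lambda>i. 1 / sqrt (real (Suc i))) i"
      by (simp only: funpow_fdiff_cmult)
    also have "(fdiff 1 ^^ j) (\<lambda>i. 1 / sqrt (real (Suc i))) i
        = (fdiff 1 ^^ j) (\<lambda>l. 1 / sqrt (real (Suc (i + 1 * l)))) 0"
      by (subst funpow_fdiff_affine) simp
    also have "(\<lambda>l. 1 / sqrt (real (Suc (i + 1 * l)))) = (\<lambda>l. F 0 (real (Suc i) + real l))"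
      by (auto simp: fun_eq_iff F_eq)
    finally have eq: "(fdiff 1 ^^ j) (\<lambda>i. x / sqrt (real (Suc i)) - 1) i
        = x * (fdiff 1 ^^ j) (\<lambda>l. F 0 (real (Suc i) + real l)) 0" .
    have "K * x \<le> (x / 2) * x" using x x0 by (intro mult_right_mono) auto
    then have ix: "(x / 2)\<^sup>2 \<le> real (Suc i)"
      using i zero_le_power2[of x] by (simp add: power2_eq_square)
    have "\<bar>(fdiff 1 ^^ j) (\<lambda>l. F 0 (real (Suc i) + real l)) 0\<bar> \<le> \<bar>c j\<bar> * (2 / x) ^ (2 * j + 1)"
    proof (rule abs_funpow_fdiff_le_deriv[where v = "(x / 2)\<^sup>2"])
      fix m u assume "u \<ge> (x / 2)\<^sup>2"
      moreover have "(x / 2)\<^sup>2 > 0" using x0 by simp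
      ultimately have u: "u > 0" by linarith
      have "- (1 / 2) - real m - 1 = - (1 / 2) - real (Suc m)" by simp
      then have "((\<lambda>u. u powr (- (1 / 2) - real m)) has_real_derivative
          (- (1 / 2) - real m) * u powr (- (1 / 2) - real (Suc m))) (at u)"
        using has_real_derivative_powr[OF u, of "- (1 / 2) - real m"] by metis
      then have "((\<lambda>u. c m * u powr (- (1 / 2) - real m)) has_real_derivative
          c m * ((- (1 / 2) - real m) * u powr (- (1 / 2) - real (Suc m)))) (at u)"
        by (rule DERIV_cmult)
      moreover have "c (Suc m) = c m * (- (1 / 2) - real m)" by (simp add: c_def)
      ultimately show "(F m has_real_derivative F (Suc m) u) (at u)"
        unfolding F_def by (simp only: mult.assoc)
    next
      fix u assume u: "u \<ge> (x / 2)\<^sup>2"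
      have x2: "(x / 2)\<^sup>2 > 0" using x0 by simp
      have "u powr (- (1 / 2) - real j) \<le> ((x / 2)\<^sup>2) powr (- (1 / 2) - real j)"
        using u x2 by (intro powr_mono2') auto
      also have "\<dots> = (x / 2) powr (- real (2 * j + 1))"
        using x0 by (simp add: powr_powr flip: powr_numeral)
      also have "\<dots> = (2 / x) ^ (2 * j + 1)"
        using x0 by (subst powr_minus, subst powr_realpow) (auto simp: power_divide)
      finally show "\<bar>F (0 + j) u\<bar> \<le> \<bar>c j\<bar> * (2 / x) ^ (2 * j + 1)"
        unfolding F_def by (simp only: abs_mult add_0) (intro mult_left_mono, auto)
    qed (use ix in simp)
    then have "\<bar>(fdiff 1 ^^ j) (\<lambda>i. x / sqrt (real (Suc i)) - 1) i\<bar>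
        \<le> x * (\<bar>c j\<bar> * (2 / x) ^ (2 * j + 1))"
      unfolding eq abs_mult using x0 by (simp only: abs_of_pos mult_left_mono less_imp_le)
    also have "\<dots> = B / x ^ (2 * j)"
      using x0 by (simp add: B_def power_divide)
    also have "\<dots> \<le> B / x ^ (j + 1)"
      using x0 Suc by (intro divide_left_mono power_increasing) (auto simp: B_def)
    also have "\<dots> = B / x * (1 / x) ^ j"
      using x0 by (simp add: power_divide)
    finally show ?thesis .
  qed
  then show ?thesis by (intro exI[of _ B]) (auto simp: B_def)
qed

text \<open>Since \<open>fdiff 1 (wt x)\<close> is \<open>wt x\<close> times its relative increment,
  the product bound raises the order by one; it needs all lower orders, so the induction carries
  every \<open>j <= a\<close> at once.\<close>

lemma fdiff_wt_bound:
  fixes K :: real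
  assumes "0 \<le> K"
  shows "\<exists>B\<ge>0. \<forall>x\<ge>2 * K + 2. \<forall>j\<le>a. \<forall>i. x\<^sup>2 - K * x \<le> real i \<and> real i + real j \<le> x\<^sup>2 \<longrightarrow>
     \<bar>(fdiff 1 ^^ j) (wt x) i\<bar> \<le> B * (1 / x) ^ j"
proof (induction a)
  case 0
  have "\<bar>wt x i\<bar> \<le> 1" if "x \<ge> 2 * K + 2" for x i
    using wt_le_1[of x i] wt_pos[of x i] that assms by simp
  then show ?case by (intro exI[of _ 1]) auto
next
  case (Suc a)
  then obtain B where B: "B \<ge> 0" "\<And>x j i. x \<ge> 2 * K + 2 \<Longrightarrow> j \<le> a \<Longrightarrow> x\<^sup>2 - K * x \<le> real i \<Longrightarrow>
      real i + real j \<le> x\<^sup>2 \<Longrightarrow> \<bar>(fdiff 1 ^^ j) (wt x) i\<bar> \<le> B * (1 / x) ^ j"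
    by blast
  obtain E where E: "\<And>j. E j \<ge> 0" "\<And>j x i. x \<ge> 2 * K + 2 \<Longrightarrow> x\<^sup>2 - K * x \<le> real i \<Longrightarrow>
      real i + 1 + real j \<le> x\<^sup>2 \<Longrightarrow>
      \<bar>(fdiff 1 ^^ j) (\<lambda>i. x / sqrt (real (Suc i)) - 1) i\<bar> \<le> E j / x * (1 / x) ^ j"
    using fdiff_wt_ratio_bound[OF assms] by metis
  define E' where "E' = (\<Sum>j\<le>a. E j)"
  have E': "E j \<le> E'" if "j \<le> a" for j
    unfolding E'_def using that E(1) by (intro member_le_sum) auto
  have E'0: "0 \<le> E'" using E(1) by (simp add: E'_def sum_nonneg)
  define B' where "B' = max B (2 ^ a * B * E')"
  have "\<bar>(fdiff 1 ^^ j) (wt x) i\<bar> \<le> B' * (1 / x) ^ j"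
    if x: "x \<ge> 2 * K + 2" and j: "j \<le> Suc a" and i: "x\<^sup>2 - K * x \<le> real i" "real i + real j \<le> x\<^sup>2"
    for x j i
  proof (cases "j \<le> a")
    case True
    have "\<bar>(fdiff 1 ^^ j) (wt x) i\<bar> \<le> B * (1 / x) ^ j"
      using B(2)[OF x True i] .
    also have "\<dots> \<le> B' * (1 / x) ^ j"
      using x assms by (intro mult_right_mono) (auto simp: B'_def)
    finally show ?thesis .
  next
    case False
    then have j: "j = Suc a" using j by simp
    have x0: "x > 0" using x assms by simp
    define \<delta> where "\<delta> = (\<lambda>i. x / sqrt (real (Suc i)) - 1)"
    \<comment> \<open>\<open>hi\<close> stops one below the floor of \<open>x^2\<close>, as the
      increment at \<open>i\<close> involves \<open>i + 1\<close>.\<close>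
    define lo hi where "lo = nat \<lceil>x\<^sup>2 - K * x\<rceil>" and "hi = nat \<lfloor>x\<^sup>2\<rfloor> - 1"
    have lo: "x\<^sup>2 - K * x \<le> real i" if "lo \<le> i" for i
      using that unfolding lo_def by linarith
    have hi1: "x\<^sup>2 - 1 \<ge> 0" using i(2) j by simp
    have hi: "real i + 1 \<le> x\<^sup>2" if "i \<le> hi" for i
      using that hi1 unfolding hi_def by linarith
    have "\<bar>(fdiff 1 ^^ a) (\<lambda>i. wt x i * \<delta> i) i\<bar> \<le> 2 ^ a * B * (E' / x) * (1 / x) ^ a"
    proof (rule abs_funpow_fdiff_mult_le[where lo = lo and hi = hi])
      fix l i assume l: "l \<le> a" "lo \<le> i" "i + l \<le> hi"
      from hi[OF l(3)] have il: "real i + 1 + real l \<le> x\<^sup>2" by simp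
      show "\<bar>(fdiff 1 ^^ l) (wt x) i\<bar> \<le> B * (1 / x) ^ l"
        using B(2)[OF x l(1) lo[OF l(2)]] il by simp
      have "\<bar>(fdiff 1 ^^ l) \<delta> i\<bar> \<le> E l / x * (1 / x) ^ l"
        unfolding \<delta>_def using E(2)[OF x lo[OF l(2)] il] .
      also have "\<dots> \<le> E' / x * (1 / x) ^ l"
        using x0 E'[OF l(1)] by (intro mult_right_mono divide_right_mono) auto
      finally show "\<bar>(fdiff 1 ^^ l) \<delta> i\<bar> \<le> E' / x * (1 / x) ^ l" .
    next
      show "lo \<le> i" unfolding lo_def using i(1) by linarith
      show "i + a \<le> hi" unfolding hi_def using i(2) unfolding j of_nat_Suc by linarith
    qed (use x0 B E'0 in auto)
    moreover have "fdiff 1 (wt x) = (\<lambda>i. wt x i * \<delta> i)"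
      by (auto simp: fun_eq_iff fdiff_def \<delta>_def wt_Suc algebra_simps)
    ultimately have "\<bar>(fdiff 1 ^^ j) (wt x) i\<bar> \<le> 2 ^ a * B * (E' / x) * (1 / x) ^ a"
      unfolding j by (simp only: funpow_Suc_right o_def)
    also have "\<dots> = (2 ^ a * B * E') * (1 / x) ^ j"
      by (simp add: j)
    also have "\<dots> \<le> B' * (1 / x) ^ j"
      using x0 by (intro mult_right_mono) (auto simp: B'_def)
    finally show ?thesis .
  qed
  moreover have "0 \<le> B'" using B(1) by (simp add: B'_def)
  ultimately show ?case by blast
qed

text \<open>The \<open>y\<^sub>i\<close> of the overview: the coefficient of \<open>\<xi> i\<close>
  in the pairing of \<open>(t, s)\<close> with the scaled sum, hence the argument of the
  characteristic function.\<close>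

definition coord :: "real \<Rightarrow> real \<Rightarrow> real \<Rightarrow> nat \<Rightarrow> real" where
  "coord x t s i = wt x i * (t + s * ((real i - x\<^sup>2) / x))"

text \<open>Product bound for \<open>wt x\<close> and an affine factor: in the window that factor is
  at most \<open>|t| + K * |s|\<close>, its first difference is \<open>s / x\<close> and its higher
  differences vanish.\<close>

lemma fdiff_coord_bound:
  fixes K :: real
  assumes "0 \<le> K"
  shows "\<exists>B\<ge>0. \<forall>x\<ge>2 * K + 2. \<forall>t s i. x\<^sup>2 - K * x \<le> real i \<and> real i + real a \<le> x\<^sup>2 \<longrightarrow>
     \<bar>(fdiff 1 ^^ a) (coord x t s) i\<bar> \<le> B * (\<bar>t\<bar> + \<bar>s\<bar>) * (1 / x) ^ a"
proof -
  obtain B where B: "B \<ge> 0" "\<And>x j i. x \<ge> 2 * K + 2 \<Longrightarrow> j \<le> a \<Longrightarrow> x\<^sup>2 - K * x \<le> real i \<Longrightarrow>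
      real i + real j \<le> x\<^sup>2 \<Longrightarrow> \<bar>(fdiff 1 ^^ j) (wt x) i\<bar> \<le> B * (1 / x) ^ j"
    using fdiff_wt_bound[OF assms, of a] by metis
  have "\<bar>(fdiff 1 ^^ a) (coord x t s) i\<bar> \<le> (2 ^ a * B * (1 + K)) * (\<bar>t\<bar> + \<bar>s\<bar>) * (1 / x) ^ a"
    if x: "x \<ge> 2 * K + 2" and i: "x\<^sup>2 - K * x \<le> real i" "real i + real a \<le> x\<^sup>2" for x t s i
  proof -
    have x0: "x > 0" using x assms by simp
    define lo hi where "lo = nat \<lceil>x\<^sup>2 - K * x\<rceil>" and "hi = nat \<lfloor>x\<^sup>2\<rfloor>"
    have lo: "x\<^sup>2 - K * x \<le> real i" if "lo \<le> i" for i
      using that unfolding lo_def by linarith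
    have hi: "real i \<le> x\<^sup>2" if "i \<le> hi" for i
      using that unfolding hi_def by (simp add: le_nat_iff le_floor_iff)
    let ?T = "\<bar>t\<bar> + \<bar>s\<bar>"
    define lin where "lin i = t + s * ((real i - x\<^sup>2) / x)" for i :: nat
    have dlin: "fdiff 1 lin = (\<lambda>i. s / x)"
      using x0 by (auto simp: fun_eq_iff fdiff_def lin_def field_simps)
    have KT: "\<bar>t\<bar> + K * \<bar>s\<bar> \<le> (1 + K) * ?T" "\<bar>s\<bar> \<le> (1 + K) * ?T"
      using assms by (simp_all add: algebra_simps add_nonneg_nonneg)
    have "\<bar>(fdiff 1 ^^ a) (\<lambda>i. wt x i * lin i) i\<bar> \<le> 2 ^ a * B * ((1 + K) * ?T) * (1 / x) ^ a"
    proof (rule abs_funpow_fdiff_mult_le[where lo = lo and hi = hi])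
      fix j i assume j: "j \<le> a" "lo \<le> i" "i + j \<le> hi"
      from hi[OF j(3)] have ij: "real i + real j \<le> x\<^sup>2" by simp
      show "\<bar>(fdiff 1 ^^ j) (wt x) i\<bar> \<le> B * (1 / x) ^ j"
        using B(2)[OF x j(1) lo[OF j(2)] ij] .
      consider "j = 0" | "j = 1" | m where "j = Suc (Suc m)"
        by (metis One_nat_def not0_implies_Suc)
      then show "\<bar>(fdiff 1 ^^ j) lin i\<bar> \<le> (1 + K) * ?T * (1 / x) ^ j"
      proof cases
        case 1
        have "\<bar>(real i - x\<^sup>2) / x\<bar> \<le> K"
          using lo[OF j(2)] ij x0 by (simp add: field_simps abs_if)
        then have "\<bar>s * ((real i - x\<^sup>2) / x)\<bar> \<le> K * \<bar>s\<bar>"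
          unfolding abs_mult by (subst (2) mult.commute) (intro mult_left_mono, auto)
        then have "\<bar>lin i\<bar> \<le> \<bar>t\<bar> + K * \<bar>s\<bar>"
          unfolding lin_def by linarith
        with KT 1 show ?thesis by simp
      next
        case 2
        have "\<bar>s\<bar> / x \<le> (1 + K) * ?T / x"
          using KT(2) x0 by (intro divide_right_mono) auto
        then show ?thesis using 2 x0 by (simp add: dlin[unfolded One_nat_def])
      next
        case 3
        have "(fdiff 1 ^^ Suc m) (\<lambda>i. s / x) = (\<lambda>i. 0)"
          by (induction m) (auto simp: fdiff_def fun_eq_iff)
        then have "(fdiff 1 ^^ j) lin = (\<lambda>i. 0)"
          unfolding 3 by (subst funpow_Suc_right) (simp only: o_def dlin)
        then show ?thesis using x0 assms by simp
      qed
    next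
      show "lo \<le> i" unfolding lo_def using i(1) by linarith
      show "i + a \<le> hi" unfolding hi_def using i(2) by (simp add: le_nat_iff le_floor_iff)
    qed (use x0 B assms in auto)
    moreover have "coord x t s = (\<lambda>i. wt x i * lin i)" by (auto simp: coord_def lin_def)
    ultimately show ?thesis by (simp add: mult.assoc)
  qed
  moreover have "0 \<le> 2 ^ a * B * (1 + K)" using B assms by simp
  ultimately show ?thesis by blast
qed

section \<open>Lower bounds for the cosine sums\<close>

text \<open>Two integrations starting from \<open>cos >= 1 / 2\<close> on \<open>[0, 1]\<close>,
  which holds because \<open>1 < pi / 3\<close>.\<close>

lemma one_minus_cos_ge:
  assumes "\<bar>u\<bar> \<le> 1"
  shows "u\<^sup>2 / 4 \<le> 1 - cos (u::real)"
proof -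
  have cos_ge: "1 / 2 \<le> cos v" if "0 \<le> v" "v \<le> 1" for v :: real
  proof -
    have "cos (pi / 3) \<le> cos v"
      using that pi_gt3 by (intro cos_monotone_0_pi_le) auto
    then show ?thesis by (simp add: cos_60)
  qed
  have sin_ge: "v / 2 \<le> sin v" if v: "0 \<le> v" "v \<le> 1" for v :: real
  proof -
    have "sin 0 - 0 / 2 \<le> sin v - v / 2"
    proof (rule DERIV_nonneg_imp_nondecreasing[OF v(1)])
      fix w :: real assume "0 \<le> w" "w \<le> v"
      then show "\<exists>y. ((\<lambda>v. sin v - v / 2) has_real_derivative y) (at w) \<and> 0 \<le> y"
        using cos_ge[of w] v by (intro exI[of _ "cos w - 1 / 2"]) (auto intro!: derivative_eq_intros)
    qed
    then show ?thesis by simp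
  qed
  have "1 - cos 0 - 0\<^sup>2 / 4 \<le> 1 - cos \<bar>u\<bar> - \<bar>u\<bar>\<^sup>2 / 4"
  proof (rule DERIV_nonneg_imp_nondecreasing[OF abs_ge_zero])
    fix w assume "0 \<le> w" "w \<le> \<bar>u\<bar>"
    then show "\<exists>y. ((\<lambda>v. 1 - cos v - v\<^sup>2 / 4) has_real_derivative y) (at w) \<and> 0 \<le> y"
      using sin_ge[of w] assms
      by (intro exI[of _ "sin w - w / 2"]) (auto intro!: derivative_eq_intros)
  qed
  then show ?thesis by simp
qed

text \<open>After reduction modulo \<open>2 * pi\<close> to \<open>[- pi, pi]\<close>, the cosine is
  decreasing in the absolute value.\<close>

lemma near_2pi_Ints_of_one_minus_cos_less:
  assumes "1 - cos u < 1 - cos \<eta>" "0 \<le> \<eta>" "\<eta> \<le> pi"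
  shows "\<exists>p::int. \<bar>u - 2 * pi * p\<bar> \<le> \<eta>"
proof -
  define p where "p = round (u / (2 * pi))"
  define v where "v = u - 2 * pi * p"
  have "\<bar>real_of_int p - u / (2 * pi)\<bar> \<le> 1 / 2"
    unfolding p_def by (rule of_int_round_abs_le)
  then have "2 * pi * \<bar>real_of_int p - u / (2 * pi)\<bar> \<le> pi" by simp
  moreover have "2 * pi * \<bar>real_of_int p - u / (2 * pi)\<bar> = \<bar>2 * pi * (real_of_int p - u / (2 * pi))\<bar>"
    by (simp add: abs_mult)
  moreover have "2 * pi * (real_of_int p - u / (2 * pi)) = - v"
    by (simp add: v_def algebra_simps)
  ultimately have v: "\<bar>v\<bar> \<le> pi" by simp
  have "cos u = cos (v + 2 * pi * p)" by (simp add: v_def)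
  also have "\<dots> = cos \<bar>v\<bar>"
    by (simp add: cos_add)
  finally have "cos \<eta> < cos \<bar>v\<bar>" using assms(1) by simp
  then have "\<bar>v\<bar> \<le> \<eta>"
    using cos_monotone_0_pi_le[of \<eta> "\<bar>v\<bar>"] assms v by linarith
  then show ?thesis unfolding v_def by blast
qed

text \<open>The linear factor \<open>t + s z\<close> can be small near \<open>z = 0\<close> or near \<open>z = - 1\<close>, but not near both.\<close>
lemma exists_offset:
  fixes x t s :: real
  assumes x: "x \<ge> 8"
  shows "\<exists>b. real b \<le> x + 1 \<and> (\<forall>r. real r \<le> x / 8 \<longrightarrow>
    (\<bar>t\<bar> + \<bar>s\<bar>) / 6 \<le> \<bar>t + s * ((real (nat \<lfloor>x\<^sup>2\<rfloor> - b - r) - x\<^sup>2) / x)\<bar>)"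
proof -
  define \<mu> where "\<mu> = nat \<lfloor>x\<^sup>2\<rfloor>"
  have \<mu>: "real \<mu> \<le> x\<^sup>2" "x\<^sup>2 - 1 \<le> real \<mu>" unfolding \<mu>_def by (simp, linarith)
  have x2: "8 * x \<le> x\<^sup>2" using x by (simp add: power2_eq_square)
  have idx: "real (\<mu> - b - r) = real \<mu> - real b - real r"
    if "real b \<le> x + 1" "real r \<le> x / 8" for b r
  proof -
    have "b + r \<le> \<mu>" using that \<mu> x2 x by linarith
    then show ?thesis by (simp add: of_nat_diff)
  qed
  show ?thesis
  \<comment> \<open>Near \<open>z = 0\<close> one has \<open>|z| <= 1 / 4\<close>, and
    \<open>|t| - |s| / 4 >= (|t| + |s|) / 6\<close> holds exactly when
    \<open>|t| >= |s| / 2\<close>; this fixes the constant. In the other case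
    \<open>z <= - 1\<close>, and \<open>|s| - |t|\<close> is large enough.\<close>
  proof (cases "\<bar>s\<bar> / 2 \<le> \<bar>t\<bar>")
    case True
    have "(\<bar>t\<bar> + \<bar>s\<bar>) / 6 \<le> \<bar>t + s * ((real (\<mu> - 0 - r) - x\<^sup>2) / x)\<bar>" if r: "real r \<le> x / 8" for r
    proof -
      define z where "z = (real (\<mu> - 0 - r) - x\<^sup>2) / x"
      have "\<bar>z\<bar> \<le> 1 / 4"
        unfolding z_def using idx[of 0 r] r \<mu> x by (simp add: field_simps abs_if)
      then have "\<bar>s * z\<bar> \<le> \<bar>s\<bar> * (1 / 4)"
        unfolding abs_mult by (intro mult_left_mono) auto
      moreover have "\<bar>t\<bar> \<le> \<bar>t + s * z\<bar> + \<bar>s * z\<bar>" by linarith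
      ultimately show ?thesis using True unfolding z_def[symmetric] by argo
    qed
    then show ?thesis using x unfolding \<mu>_def by (intro exI[of _ 0]) auto
  next
    case False
    define b where "b = nat \<lceil>x\<rceil>"
    have b: "real b \<le> x + 1" "x \<le> real b" using x unfolding b_def by linarith+
    have "(\<bar>t\<bar> + \<bar>s\<bar>) / 6 \<le> \<bar>t + s * ((real (\<mu> - b - r) - x\<^sup>2) / x)\<bar>" if r: "real r \<le> x / 8" for r
    proof -
      define z where "z = (real (\<mu> - b - r) - x\<^sup>2) / x"
      have "z \<le> - 1"
        unfolding z_def using idx[OF b(1) r] b \<mu> x by (simp add: field_simps)
      then have "\<bar>s\<bar> * 1 \<le> \<bar>s * z\<bar>"
        unfolding abs_mult by (intro mult_left_mono) auto
      moreover have "\<bar>s * z\<bar> \<le> \<bar>t + s * z\<bar> + \<bar>t\<bar>" by linarith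
      ultimately show ?thesis using False unfolding z_def[symmetric] by argo
    qed
    then show ?thesis using b(1) unfolding \<mu>_def by blast
  qed
qed

text \<open>Near \<open>x^2\<close> all arguments are at most 1 in this range, so
  \<open>1 - cos\<close> is at least a quarter of the square. About \<open>x / 8\<close> consecutive
  indices provided by \<open>exists_offset\<close> contribute order \<open>(|t| + |s|)^2 / x\<close>
  each.\<close>

lemma sum_cos_coord_ge_low:
  "\<exists>c0>0. \<exists>c>0. \<forall>x\<ge>8. \<forall>n t s. x\<^sup>2 \<le> real n \<and> \<bar>t\<bar> + \<bar>s\<bar> \<le> c0 * sqrt x \<longrightarrow>
    c * (\<bar>t\<bar> + \<bar>s\<bar>)\<^sup>2 \<le> (\<Sum>i=1..n. 1 - cos (coord x t s i))"
proof -
  \<comment> \<open>\<open>c0\<close> cancels the factor \<open>2 * exp 4\<close> in the upper bound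
    for the coordinates. In \<open>c\<close>, 1152 is \<open>8 * 36 * 4\<close>: the number of
    indices, the squared offset constant and the quadratic bound for the cosine.\<close>
  define c0 :: real where "c0 = exp (- 4) / 2"
  define c :: real where "c = exp (- 10) / 1152"
  have "c * (\<bar>t\<bar> + \<bar>s\<bar>)\<^sup>2 \<le> (\<Sum>i=1..n. 1 - cos (coord x t s i))"
    if x: "x \<ge> 8" and n: "x\<^sup>2 \<le> real n" and ts: "\<bar>t\<bar> + \<bar>s\<bar> \<le> c0 * sqrt x" for x n t s
  proof -
    define \<mu> where "\<mu> = nat \<lfloor>x\<^sup>2\<rfloor>"
    define T where "T = \<bar>t\<bar> + \<bar>s\<bar>"
    have \<mu>: "real \<mu> \<le> x\<^sup>2" "x\<^sup>2 - 1 \<le> real \<mu>" unfolding \<mu>_def by (simp, linarith)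
    have x2: "8 * x \<le> x\<^sup>2" using x by (simp add: power2_eq_square)
    obtain b where b: "real b \<le> x + 1"
      "\<And>r. real r \<le> x / 8 \<Longrightarrow> T / 6 \<le> \<bar>t + s * ((real (\<mu> - b - r) - x\<^sup>2) / x)\<bar>"
      using exists_offset[OF x, of t s] unfolding T_def \<mu>_def by blast
    define m where "m = nat \<lfloor>x / 8\<rfloor>"
    have m: "real m \<le> x / 8" "x / 8 \<le> real (Suc m)" using x unfolding m_def by linarith+
    have tm: "(exp (- 5) / sqrt x * (T / 6))\<^sup>2 / 4 \<le> 1 - cos (coord x t s (\<mu> - b - r))"
      if r: "r \<le> m" for r
    proof -
      have rx: "real r \<le> x / 8" using r m(1) by simp
      define i where "i = \<mu> - b - r"
      have "b + r \<le> \<mu>" using b rx \<mu> x2 x by linarith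
      then have i: "real i = real \<mu> - real b - real r" by (simp add: i_def of_nat_diff)
      have ix: "x\<^sup>2 - 2 * x \<le> real i" "real i \<le> x\<^sup>2" using i \<mu> b rx x by linarith+
      have z: "\<bar>(real i - x\<^sup>2) / x\<bar> \<le> 2" using ix x by (simp add: field_simps abs_if)
      then have "\<bar>s * ((real i - x\<^sup>2) / x)\<bar> \<le> \<bar>s\<bar> * 2"
        unfolding abs_mult by (intro mult_left_mono) auto
      then have up: "\<bar>t + s * ((real i - x\<^sup>2) / x)\<bar> \<le> 2 * T"
        using abs_triangle_ineq[of t "s * ((real i - x\<^sup>2) / x)"] abs_ge_zero[of t]
        unfolding T_def by argo
      have lo: "T / 6 \<le> \<bar>t + s * ((real i - x\<^sup>2) / x)\<bar>" using b(2)[OF rx] by (simp add: i_def)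
      have w: "exp (- 5) / sqrt x \<le> wt x i" "wt x i \<le> exp 4 / sqrt x"
        using wt_bounds[of x i] x ix by auto
      have w0: "0 < wt x i" using x by (intro wt_pos) auto
      have abs_eq: "\<bar>coord x t s i\<bar> = wt x i * \<bar>t + s * ((real i - x\<^sup>2) / x)\<bar>"
        unfolding coord_def abs_mult using w0 by simp
      have "\<bar>coord x t s i\<bar> \<le> exp 4 / sqrt x * (2 * T)"
        unfolding abs_eq using w up w0 x by (intro mult_mono) auto
      also have "\<dots> \<le> exp 4 / sqrt x * (2 * (c0 * sqrt x))"
        using ts x unfolding T_def by (intro mult_left_mono) auto
      also have "\<dots> = 1" using x by (simp add: c0_def exp_minus)
      finally have le1: "\<bar>coord x t s i\<bar> \<le> 1" .
      have "exp (- 5) / sqrt x * (T / 6) \<le> \<bar>coord x t s i\<bar>"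
        unfolding abs_eq using w lo w0 x by (intro mult_mono) (auto simp: T_def)
      then have "(exp (- 5) / sqrt x * (T / 6))\<^sup>2 \<le> \<bar>coord x t s i\<bar>\<^sup>2"
        using x by (intro power_mono) (auto simp: T_def)
      then show ?thesis using one_minus_cos_ge[OF le1] unfolding i_def[symmetric] by simp
    qed
    have inj: "inj_on (\<lambda>r. \<mu> - b - r) {..m}"
    proof (rule inj_onI)
      fix r r' assume rr: "r \<in> {..m}" "r' \<in> {..m}" "\<mu> - b - r = \<mu> - b - r'"
      have "b + r \<le> \<mu>" "b + r' \<le> \<mu>" using rr b m \<mu> x2 x by auto
      then show "r = r'" using rr by linarith
    qed
    have sub: "(\<lambda>r. \<mu> - b - r) ` {..m} \<subseteq> {1..n}"
    proof (rule image_subsetI)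
      fix r assume r: "r \<in> {..m}"
      have "b + r + 1 \<le> \<mu>" using r b m \<mu> x2 x by auto
      moreover have "\<mu> \<le> n" using \<mu> n by linarith
      ultimately show "\<mu> - b - r \<in> {1..n}" by auto
    qed
    have "c * T\<^sup>2 = x / 8 * ((exp (- 5) / sqrt x * (T / 6))\<^sup>2 / 4)"
      using x by (simp add: c_def power_mult_distrib power_divide exp_double[symmetric])
    also have "\<dots> \<le> real (Suc m) * ((exp (- 5) / sqrt x * (T / 6))\<^sup>2 / 4)"
      using m by (intro mult_right_mono) auto
    also have "\<dots> = (\<Sum>r\<le>m. (exp (- 5) / sqrt x * (T / 6))\<^sup>2 / 4)" by simp
    also have "\<dots> \<le> (\<Sum>r\<le>m. 1 - cos (coord x t s (\<mu> - b - r)))"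
      using tm by (intro sum_mono) auto
    also have "\<dots> = (\<Sum>i\<in>(\<lambda>r. \<mu> - b - r) ` {..m}. 1 - cos (coord x t s i))"
      by (simp only: sum.reindex[OF inj] o_def)
    also have "\<dots> \<le> (\<Sum>i=1..n. 1 - cos (coord x t s i))"
      using sub by (intro sum_mono2) auto
    finally show ?thesis by (simp add: T_def)
  qed
  moreover have "c0 > 0" "c > 0" by (simp_all add: c0_def c_def)
  ultimately show ?thesis by blast
qed

text \<open>With \<open>d = nat \<lfloor>sqrt x\<rfloor>\<close>, the equation \<open>i + r + d * q = \<nu>\<close> places \<open>i\<close> in the residue class of
  \<open>\<nu> - r\<close> modulo \<open>d\<close>, so that distinct \<open>r < d\<close> yield distinct \<open>i\<close>.\<close>
lemma exists_coord_far_from_2pi_Ints: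
  assumes "c0 > 0"
  shows "\<exists>\<epsilon>>0. \<exists>K\<ge>0. \<exists>X0. \<forall>x\<ge>X0. \<forall>t s. c0 * sqrt x \<le> \<bar>t\<bar> + \<bar>s\<bar> \<and> \<bar>t\<bar> + \<bar>s\<bar> \<le> x ^ p \<longrightarrow>
    (\<exists>\<nu>. \<forall>r. real r < real (nat \<lfloor>sqrt x\<rfloor>) \<longrightarrow>
      (\<exists>i q. i + r + nat \<lfloor>sqrt x\<rfloor> * q = \<nu> \<and> x\<^sup>2 - K * x \<le> real i \<and> real i \<le> x\<^sup>2 \<and>
         \<epsilon> \<le> 1 - cos (coord x t s i)))"
proof -
  \<comment> \<open>With step \<open>d <= sqrt x\<close> and \<open>|t| + |s| <= x ^ p\<close>, the
    \<open>k\<close>-th difference is at most a constant times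
    \<open>x ^ (p + 1) * x ^ p / x ^ k = 1 / x\<close>.\<close>
  define k where "k = 2 * p + 2"
  \<comment> \<open>The long step \<open>d * h\<close> will exceed \<open>c * x\<close>. This value
    of \<open>c\<close> makes \<open>dom\<close> hold although \<open>K\<close> depends on
    \<open>c\<close>: the Gaussian factor beats the linear growth of \<open>K\<close>.\<close>
  define c :: nat where "c = 24 * (6 + 2 * k) * 2 ^ k"
  \<comment> \<open>Window for \<open>k\<close> long steps of length at most
    \<open>(c + 1) * x\<close>, with \<open>4 * x\<close> to spare for the offset, the residue and
    rounding.\<close>
  define K where "K = real ((c + 1) * k + 4)"
  have K0: "0 \<le> K" by (simp add: K_def)
  obtain B where B: "B \<ge> 0" "\<And>x t s i. x \<ge> 2 * K + 2 \<Longrightarrow> x\<^sup>2 - K * x \<le> real i \<Longrightarrow>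
      real i + real k \<le> x\<^sup>2 \<Longrightarrow>
      \<bar>(fdiff 1 ^^ k) (coord x t s) i\<bar> \<le> B * (\<bar>t\<bar> + \<bar>s\<bar>) * (1 / x) ^ k"
    using fdiff_coord_bound[OF K0, of k] by metis
  \<comment> \<open>Small enough for the integrality argument
    (\<open>2 ^ k * \<eta> \<le> 1\<close>) and for the final contradiction.\<close>
  define \<eta> where "\<eta> = min 1 (exp (- 5) * c0 / 24) / 2 ^ k"
  have \<eta>: "0 < \<eta>" "2 ^ k * \<eta> \<le> 1" "2 ^ k * \<eta> < exp (- 5) * c0 / 12"
    using assms by (auto simp: \<eta>_def min_def)
  have "\<eta> \<le> 2 ^ k * \<eta>" using \<eta>(1) by simp
  then have \<eta>_pi: "\<eta> < pi" using \<eta>(2) pi_gt3 by linarith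
  define \<epsilon> where "\<epsilon> = 1 - cos \<eta>"
  have \<epsilon>0: "\<epsilon> > 0"
    using cos_monotone_0_pi[of 0 \<eta>] \<eta>(1) \<eta>_pi by (simp add: \<epsilon>_def)
  have "24 * 1 * 1 \<le> c" unfolding c_def by (intro mult_mono) auto
  then have c1: "c \<ge> 24" by simp
  have dom: "2 ^ k * (exp (- (real c ^ 2 / 4)) * (1 + K)) \<le> 1 / 12"
  proof -
    have "1 + K \<le> (6 + 2 * real k) * real c"
    proof -
      have "1 + K = 5 + real k + real k * real c" by (simp add: K_def algebra_simps)
      also have "\<dots> \<le> 5 * real c + real k * real c + real k * real c"
        using c1 by (intro add_mono) (simp_all add: mult_le_cancel_left1)
      also have "\<dots> \<le> (6 + 2 * real k) * real c" by (simp add: algebra_simps)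
      finally show ?thesis .
    qed
    moreover have "exp (- (real c ^ 2 / 4)) \<le> 2 / real c ^ 2"
    proof -
      have "4 * real c \<le> real c * real c" using c1 by (intro mult_right_mono) auto
      then have "exp (real c) \<le> exp (real c ^ 2 / 4)" by (simp add: power2_eq_square)
      moreover have "real c ^ 2 / 2 \<le> exp (real c)"
        using exp_lower_Taylor_quadratic[of "real c"] by simp
      ultimately have "real c ^ 2 / 2 \<le> exp (real c ^ 2 / 4)" by (meson order_trans)
      then show ?thesis using c1 by (simp add: exp_minus field_simps)
    qed
    ultimately have "2 ^ k * (exp (- (real c ^ 2 / 4)) * (1 + K))
        \<le> 2 ^ k * ((2 / real c ^ 2) * ((6 + 2 * real k) * real c))"
      using K0 by (intro mult_left_mono mult_mono) auto
    also have "\<dots> = (2 * (6 + 2 * real k) * 2 ^ k) / real c"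
      using c1 by (simp add: power2_eq_square)
    also have "\<dots> = 1 / 12"
    proof -
      have "real c = 12 * (2 * (6 + 2 * real k) * 2 ^ k)" by (simp add: c_def)
      moreover have "2 * (6 + 2 * real k) * 2 ^ k > 0" by (simp add: add_pos_nonneg)
      ultimately show ?thesis by simp
    qed
    finally show ?thesis .
  qed
  define X0 where "X0 = max 100 (max (2 * K + 2) B)"
  have main: "\<exists>\<nu>. \<forall>r. real r < real (nat \<lfloor>sqrt x\<rfloor>) \<longrightarrow>
      (\<exists>i q. i + r + nat \<lfloor>sqrt x\<rfloor> * q = \<nu> \<and> x\<^sup>2 - K * x \<le> real i \<and> real i \<le> x\<^sup>2 \<and>
         \<epsilon> \<le> 1 - cos (coord x t s i))"
    if xX: "x \<ge> X0" and T1: "c0 * sqrt x \<le> \<bar>t\<bar> + \<bar>s\<bar>" and T2: "\<bar>t\<bar> + \<bar>s\<bar> \<le> x ^ p" for x t s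
  proof -
    have x: "x \<ge> 100" "x \<ge> 2 * K + 2" "x \<ge> B" using xX by (auto simp: X0_def)
    define T where "T = \<bar>t\<bar> + \<bar>s\<bar>"
    define \<mu> where "\<mu> = nat \<lfloor>x\<^sup>2\<rfloor>"
    define d where "d = nat \<lfloor>sqrt x\<rfloor>"
    have \<mu>: "real \<mu> \<le> x\<^sup>2" "x\<^sup>2 - 1 \<le> real \<mu>" unfolding \<mu>_def by (simp, linarith)
    have sx: "10 \<le> sqrt x" using x by (intro real_le_rsqrt) auto
    have d: "real d \<le> sqrt x" "9 \<le> real d" using sx unfolding d_def by linarith+
    have "10 * sqrt x \<le> sqrt x * sqrt x" using sx x by (intro mult_right_mono) auto
    moreover have "sqrt x * sqrt x = x" using x by simp
    ultimately have sx8: "sqrt x \<le> x / 10" by linarith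
    have KK: "K * x \<le> x\<^sup>2" unfolding power2_eq_square using x K0 by (intro mult_right_mono) auto
    obtain b where b: "real b \<le> x + 1"
      "\<And>r. real r \<le> x / 8 \<Longrightarrow> T / 6 \<le> \<bar>t + s * ((real (\<mu> - b - r) - x\<^sup>2) / x)\<bar>"
      using exists_offset[of x t s] x unfolding T_def \<mu>_def by auto
    \<comment> \<open>The long step is a multiple of \<open>d\<close> between
      \<open>c * x + 1\<close> and \<open>(c + 1) * x\<close>; the extra 1 serves the product
      \<open>m * (m - 1)\<close> in \<open>wt_decay\<close>.\<close>
    define h where "h = nat \<lceil>(real c * x + 1) / real d\<rceil>"
    have "(real c * x + 1) / real d \<le> real h" unfolding h_def using x d by simp
    then have m1: "real c * x + 1 \<le> real (d * h)" using d by (simp add: field_simps)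
    have "real h \<le> (real c * x + 1) / real d + 1" unfolding h_def using x d by simp
    then have "real d * real h \<le> real d * ((real c * x + 1) / real d + 1)"
      by (intro mult_left_mono) auto
    also have "\<dots> = real c * x + 1 + real d" using d by (simp add: field_simps)
    also have "\<dots> \<le> (real c + 1) * x" using d sx8 x by (simp add: algebra_simps)
    finally have m2: "real (d * h) \<le> (real c + 1) * x" by simp
    have "\<exists>i q. i + r + d * q = \<mu> - b \<and> x\<^sup>2 - K * x \<le> real i \<and> real i \<le> x\<^sup>2 \<and>
         \<epsilon> \<le> 1 - cos (coord x t s i)" if r: "real r < real d" for r
    proof (rule ccontr)
      assume neg: "\<not> ?thesis"
      have rx: "real r \<le> x / 10" using r d sx8 by linarith
      define M where "M = d * h * k"
      have M: "real M \<le> (K - 4) * x"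
      proof -
        have "real M \<le> (real c + 1) * x * real k"
          unfolding M_def of_nat_mult[of "d * h"] using m2 by (intro mult_right_mono) auto
        also have "\<dots> = (K - 4) * x" by (simp add: K_def algebra_simps)
        finally show ?thesis .
      qed
      have brM: "real b + real r + real M \<le> real \<mu>"
        using b(1) rx M \<mu> KK x(1) unfolding left_diff_distrib by linarith
      \<comment> \<open>\<open>i1\<close> is the top of the progression and \<open>i0\<close> its
        bottom, \<open>h * k\<close> steps of length \<open>d\<close> lower.\<close>
      define i1 where "i1 = \<mu> - b - r"
      define i0 where "i0 = i1 - M"
      have nat_le: "b + r + M \<le> \<mu>" using brM by linarith
      have i1: "real i1 = real \<mu> - real b - real r" using nat_le by (simp add: i1_def of_nat_diff)
      have i0: "i0 + M = i1" using nat_le by (simp add: i0_def i1_def)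
      have i0r: "real i0 = real i1 - real M" using i0 by simp
      have i1x: "x\<^sup>2 - 2 * x \<le> real i1" "real i1 \<le> x\<^sup>2" using i1 \<mu> b rx x by linarith+
      have i0x: "x\<^sup>2 - K * x \<le> real i0"
        using i0r i1x M by (simp add: algebra_simps)
      define f where "f l = coord x t s (i0 + d * l)" for l
      have idx: "i0 + d * l + r + d * (h * k - l) = \<mu> - b" if "l \<le> h * k" for l
      proof -
        have "d * l + d * (h * k - l) = d * (l + (h * k - l))"
          by (simp only: distrib_left)
        also have "\<dots> = M" using that by (simp add: M_def mult.assoc)
        finally have "d * l + d * (h * k - l) = M" .
        then show ?thesis using i0 nat_le unfolding i1_def by linarith
      qed
      have le_i1: "i0 + d * l \<le> i1" if "l \<le> h * k" for l
        using idx[OF that] nat_le unfolding i1_def by linarith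
      have bound: "\<bar>(fdiff h ^^ k) f 0\<bar> \<le> 2 ^ k * \<eta>"
      proof (rule funpow_fdiff_le_of_near_2pi_Ints[OF _ _ \<eta>(2)])
        fix l assume l: "l \<le> h * k"
        have "real (i0 + d * l) \<le> x\<^sup>2" using le_i1[OF l] i1x(2) by linarith
        moreover have "x\<^sup>2 - K * x \<le> real (i0 + d * l)"
          using i0x by (simp add: add_increasing2)
        \<comment> \<open>The negated claim, with \<open>q = h * k - l\<close>, puts every term of
          the progression near a multiple of \<open>2 * pi\<close>.\<close>
        ultimately have "1 - cos (f l) < \<epsilon>"
          using neg idx[OF l] unfolding f_def by force
        then show "\<exists>p::int. \<bar>f l - 2 * pi * p\<bar> \<le> \<eta>"
          using \<eta> \<eta>_pi unfolding \<epsilon>_def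
          by (intro near_2pi_Ints_of_one_minus_cos_less) auto
      next
        fix l assume l: "l + k \<le> h * k"
        have "(fdiff 1 ^^ k) f l = (fdiff d ^^ k) (coord x t s) (i0 + d * l)"
          unfolding f_def by (subst funpow_fdiff_affine) simp
        also have "\<bar>\<dots>\<bar> \<le> real d ^ k * (B * T * (1 / x) ^ k)"
        proof (rule abs_funpow_fdiff_le_step[where lo = i0 and hi = i1])
          fix i assume i: "i + k \<le> i1" "i0 \<le> i"
          show "\<bar>(fdiff 1 ^^ k) (coord x t s) i\<bar> \<le> B * T * (1 / x) ^ k"
            unfolding T_def by (rule B(2)) (use x i i0x i1x in linarith)+
        next
          show "i0 + d * l + d * k \<le> i1"
            using le_i1[OF l] by (simp add: algebra_simps)
        qed simp
        also have "\<dots> \<le> sqrt x ^ k * (B * x ^ p * (1 / x) ^ k)"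
          using d T2 B x unfolding T_def
          by (intro mult_mono power_mono mult_nonneg_nonneg) auto
        also have "sqrt x ^ k = x ^ (p + 1)"
        proof -
          have "sqrt x ^ k = (sqrt x ^ 2) ^ (p + 1)"
            unfolding power_mult[symmetric] by (simp add: k_def)
          then show ?thesis using x by simp
        qed
        also have "x ^ (p + 1) * (B * x ^ p * (1 / x) ^ k) = B / x"
        proof -
          have "x ^ k = x ^ (p + 1) * x ^ p * x"
            unfolding k_def by (simp flip: power_add power_Suc2) (simp add: mult_2)
          then show ?thesis using x by (simp add: power_divide)
        qed
        also have "\<dots> \<le> 1" using x by simp
        finally show "\<bar>(fdiff 1 ^^ k) f l\<bar> \<le> 1" .
      qed
      define w where "w = wt x i1"
      have w0: "w > 0" using x unfolding w_def by (intro wt_pos) auto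
      have T0: "T \<ge> 0" by (simp add: T_def)
      \<comment> \<open>Bound for the terms below the top: at least one long step lower, the weight
        has lost the Gaussian factor.\<close>
      define L where "L = exp (- (real c ^ 2 / 4)) * w * ((1 + K) * T)"
      have "\<bar>(fdiff h ^^ k) f 0 - f (0 + h * k)\<bar> \<le> 2 ^ k * L"
      proof (rule abs_funpow_fdiff_minus_top_le)
        fix j assume j: "j < k"
        define i where "i = i0 + d * (h * j)"
        have ji: "i + d * h * (k - j) = i1"
        proof -
          have "d * (h * j) + d * h * (k - j) = d * h * (j + (k - j))"
            by (simp only: distrib_left mult.assoc)
          also have "\<dots> = M" using j by (simp add: M_def)
          finally have "d * (h * j) + d * h * (k - j) = M" .
          then show ?thesis using i0 unfolding i_def by linarith
        qed
        have "d * h * 1 \<le> d * h * (k - j)" using j by (intro mult_left_mono) auto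
        then have i_le: "i \<le> i1 - d * h" "d * h \<le> i1" using ji by linarith+
        have "i0 \<le> i" unfolding i_def by simp
        then have ix: "x\<^sup>2 - K * x \<le> real i" "real i \<le> x\<^sup>2"
          using i0x i_le i1x by linarith+
        have "\<bar>(real i - x\<^sup>2) / x\<bar> \<le> K" using ix x K0 by (simp add: field_simps abs_if)
        then have "\<bar>s * ((real i - x\<^sup>2) / x)\<bar> \<le> \<bar>s\<bar> * K"
          unfolding abs_mult by (intro mult_left_mono) auto
        moreover have "\<bar>s\<bar> * K \<le> T * K" "\<bar>t\<bar> \<le> T"
          using K0 unfolding T_def by (auto intro: mult_right_mono)
        ultimately have lin: "\<bar>t + s * ((real i - x\<^sup>2) / x)\<bar> \<le> (1 + K) * T"
          using abs_triangle_ineq[of t "s * ((real i - x\<^sup>2) / x)"]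
          unfolding distrib_right by (simp add: mult.commute)
        have "real (i1 - d * h) \<le> x\<^sup>2" using i1x by linarith
        then have "wt x i \<le> wt x (i1 - d * h)"
          using i_le x by (intro wt_mono) auto
        also have "\<dots> \<le> exp (- (real (d * h) * (real (d * h) - 1) / (4 * x\<^sup>2))) * w"
          unfolding w_def using i_le i1x x by (intro wt_decay) auto
        also have "\<dots> \<le> exp (- (real c ^ 2 / 4)) * w"
        proof -
          have "(real c * x) * (real c * x) \<le> real (d * h) * (real (d * h) - 1)"
            using m1 x by (intro mult_mono) auto
          then have "real c ^ 2 / 4 \<le> real (d * h) * (real (d * h) - 1) / (4 * x\<^sup>2)"
            using x by (simp add: field_simps power2_eq_square)
          then show ?thesis using w0 by (intro mult_right_mono) auto
        qed
        finally have "wt x i \<le> exp (- (real c ^ 2 / 4)) * w" .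
        moreover have "0 < wt x i" using x by (intro wt_pos) auto
        ultimately have "\<bar>coord x t s i\<bar> \<le> L"
          unfolding coord_def abs_mult L_def using lin w0
          by (intro mult_mono) auto
        then show "\<bar>f (0 + h * j)\<bar> \<le> L" by (simp add: f_def i_def)
      next
        show "0 \<le> L" using w0 T0 K0 by (simp add: L_def)
      qed
      moreover have "2 ^ k * L \<le> w * T / 12"
      proof -
        have "2 ^ k * L = (2 ^ k * (exp (- (real c ^ 2 / 4)) * (1 + K))) * (w * T)"
          by (simp add: L_def)
        also have "\<dots> \<le> 1 / 12 * (w * T)"
          using dom w0 T0 by (intro mult_right_mono) auto
        finally show ?thesis by simp
      qed
      moreover have "w * T / 6 \<le> \<bar>f (0 + h * k)\<bar>"
      proof -
        have "i0 + d * (h * k) = i1" using i0 by (simp add: M_def mult.assoc)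
        then have "\<bar>f (0 + h * k)\<bar> = w * \<bar>t + s * ((real i1 - x\<^sup>2) / x)\<bar>"
          using w0 by (simp add: f_def coord_def abs_mult w_def)
        moreover have "T / 6 \<le> \<bar>t + s * ((real i1 - x\<^sup>2) / x)\<bar>"
          using b(2)[of r] rx x unfolding i1_def by simp
        ultimately show ?thesis using w0 mult_left_mono[of "T / 6" _ w] by auto
      qed
      moreover have "exp (- 5) * c0 \<le> w * T"
      proof -
        have "exp (- 5) * c0 = (exp (- 5) / sqrt x) * (c0 * sqrt x)" using x by simp
        also have "\<dots> \<le> w * T"
          unfolding T_def using wt_bounds(1)[of x i1] i1x x T1 assms w0 unfolding w_def
          by (intro mult_mono) auto
        finally show ?thesis .
      qed
      \<comment> \<open>The top term is at least \<open>w * T / 6\<close> and the rest at most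
        \<open>w * T / 12\<close>, so the long difference is at least
        \<open>exp (- 5) * c0 / 12\<close>, against \<open>bound\<close>.\<close>
      ultimately show False using bound \<eta>(3) by linarith
    qed
    then show ?thesis unfolding d_def by blast
  qed
  show ?thesis using \<epsilon>0 K0 main by blast
qed

text \<open>Each of the \<open>d\<close> residues, with \<open>d\<close> of order
  \<open>sqrt x\<close>, supplies its own index contributing at least
  \<open>\<epsilon>\<close>.\<close>

lemma sum_cos_coord_ge_high:
  assumes "c0 > 0"
  shows "\<exists>c>0. \<exists>X0. \<forall>x\<ge>X0. \<forall>n t s.
    x\<^sup>2 \<le> real n \<and> c0 * sqrt x \<le> \<bar>t\<bar> + \<bar>s\<bar> \<and> \<bar>t\<bar> + \<bar>s\<bar> \<le> x ^ p \<longrightarrow>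
    c * sqrt x \<le> (\<Sum>i=1..n. 1 - cos (coord x t s i))"
proof -
  obtain \<epsilon> K X0 where \<epsilon>: "\<epsilon> > 0" "K \<ge> 0" and X0: "\<And>x t s. x \<ge> X0 \<Longrightarrow> c0 * sqrt x \<le> \<bar>t\<bar> + \<bar>s\<bar> \<Longrightarrow>
    \<bar>t\<bar> + \<bar>s\<bar> \<le> x ^ p \<Longrightarrow> \<exists>\<nu>. \<forall>r. real r < real (nat \<lfloor>sqrt x\<rfloor>) \<longrightarrow>
      (\<exists>i q. i + r + nat \<lfloor>sqrt x\<rfloor> * q = \<nu> \<and> x\<^sup>2 - K * x \<le> real i \<and> real i \<le> x\<^sup>2 \<and>
         \<epsilon> \<le> 1 - cos (coord x t s i))"
    using exists_coord_far_from_2pi_Ints[OF assms, of p] by blast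
  have "\<epsilon> / 2 * sqrt x \<le> (\<Sum>i=1..n. 1 - cos (coord x t s i))"
    if x: "x \<ge> max (max X0 4) (K + 1)" and n: "x\<^sup>2 \<le> real n"
      and T: "c0 * sqrt x \<le> \<bar>t\<bar> + \<bar>s\<bar>" "\<bar>t\<bar> + \<bar>s\<bar> \<le> x ^ p" for x t s n
  proof -
    define d where "d = nat \<lfloor>sqrt x\<rfloor>"
    have "2 \<le> sqrt x" using x by (intro real_le_rsqrt) auto
    then have d: "sqrt x / 2 \<le> real d" "d > 0" unfolding d_def by linarith+
    obtain \<nu> where "\<forall>r. real r < real d \<longrightarrow>
      (\<exists>i q. i + r + d * q = \<nu> \<and> x\<^sup>2 - K * x \<le> real i \<and> real i \<le> x\<^sup>2 \<and>
         \<epsilon> \<le> 1 - cos (coord x t s i))"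
      using X0[OF _ T] x unfolding d_def by auto
    then have "\<forall>r\<in>{..<d}. \<exists>i. \<exists>q. i + r + d * q = \<nu> \<and> x\<^sup>2 - K * x \<le> real i \<and> real i \<le> x\<^sup>2 \<and>
         \<epsilon> \<le> 1 - cos (coord x t s i)" by simp
    then obtain g where g: "\<And>r. r < d \<Longrightarrow> \<exists>q. g r + r + d * q = \<nu> \<and> x\<^sup>2 - K * x \<le> real (g r)
         \<and> real (g r) \<le> x\<^sup>2 \<and> \<epsilon> \<le> 1 - cos (coord x t s (g r))"
      by (metis lessThan_iff)
    have inj: "inj_on g {..<d}"
    proof (rule inj_onI)
      fix r r' assume r: "r \<in> {..<d}" "r' \<in> {..<d}" "g r = g r'"
      obtain q q' where "g r + r + d * q = \<nu>" "g r' + r' + d * q' = \<nu>"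
        using g r by (meson lessThan_iff)
      then have "r + d * q = r' + d * q'" using r(3) by linarith
      then have "(r + d * q) mod d = (r' + d * q') mod d" by simp
      then show "r = r'" using r by simp
    qed
    have sub: "g ` {..<d} \<subseteq> {1..n}"
    proof (rule image_subsetI)
      fix r assume "r \<in> {..<d}"
      then have gr: "x\<^sup>2 - K * x \<le> real (g r)" "real (g r) \<le> x\<^sup>2" using g[of r] by auto
      \<comment> \<open>\<open>x >= K + 1\<close> keeps the indices positive, as the sum starts at
        1.\<close>
      have "1 * 1 \<le> (x - K) * x" using x \<epsilon>(2) by (intro mult_mono) auto
      then have "1 \<le> real (g r)" using gr by (simp add: algebra_simps power2_eq_square)
      then show "g r \<in> {1..n}" using gr n by auto
    qed
    have "\<epsilon> / 2 * sqrt x \<le> real d * \<epsilon>" using d mult_right_mono[OF d(1), of \<epsilon>] \<epsilon> by simp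
    also have "\<dots> = (\<Sum>r<d. \<epsilon>)" by simp
    also have "\<dots> \<le> (\<Sum>r<d. 1 - cos (coord x t s (g r)))"
      using g by (intro sum_mono) auto
    also have "\<dots> = (\<Sum>i\<in>g ` {..<d}. 1 - cos (coord x t s i))"
      by (simp only: sum.reindex[OF inj] o_def)
    also have "\<dots> \<le> (\<Sum>i=1..n. 1 - cos (coord x t s i))"
      using sub by (intro sum_mono2) auto
    finally show ?thesis .
  qed
  then show ?thesis using \<epsilon> by (meson half_gt_zero)
qed

text \<open>The low range fixes \<open>c0\<close>, and the high range is then opened at this
  \<open>c0\<close>, so the two cover everything up to \<open>x ^ p\<close>.\<close>

lemma sum_cos_coord_ge:
  "\<exists>c>0. \<exists>X0. \<forall>x\<ge>X0. \<forall>n t s. x\<^sup>2 \<le> real n \<and> \<bar>t\<bar> + \<bar>s\<bar> \<le> x ^ p \<longrightarrow>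
    min (c * (\<bar>t\<bar> + \<bar>s\<bar>)\<^sup>2) (c * sqrt x) \<le> (\<Sum>i=1..n. 1 - cos (coord x t s i))"
proof -
  obtain c0 c where c: "c0 > 0" "c > 0" and low: "\<And>x n t s. x \<ge> 8 \<Longrightarrow> x\<^sup>2 \<le> real n \<Longrightarrow>
      \<bar>t\<bar> + \<bar>s\<bar> \<le> c0 * sqrt x \<Longrightarrow> c * (\<bar>t\<bar> + \<bar>s\<bar>)\<^sup>2 \<le> (\<Sum>i=1..n. 1 - cos (coord x t s i))"
    using sum_cos_coord_ge_low by blast
  obtain c' X0 where c': "c' > 0" and high: "\<And>x n t s. x \<ge> X0 \<Longrightarrow> x\<^sup>2 \<le> real n \<Longrightarrow>
      c0 * sqrt x \<le> \<bar>t\<bar> + \<bar>s\<bar> \<Longrightarrow> \<bar>t\<bar> + \<bar>s\<bar> \<le> x ^ p \<Longrightarrow>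
      c' * sqrt x \<le> (\<Sum>i=1..n. 1 - cos (coord x t s i))"
    using sum_cos_coord_ge_high[OF c(1), of p] by blast
  have "min (min c c' * (\<bar>t\<bar> + \<bar>s\<bar>)\<^sup>2) (min c c' * sqrt x) \<le> (\<Sum>i=1..n. 1 - cos (coord x t s i))"
    if x: "x \<ge> max X0 8" and n: "x\<^sup>2 \<le> real n" and T: "\<bar>t\<bar> + \<bar>s\<bar> \<le> x ^ p" for x n t s
  proof (cases "\<bar>t\<bar> + \<bar>s\<bar> \<le> c0 * sqrt x")
    case True
    have "min c c' * (\<bar>t\<bar> + \<bar>s\<bar>)\<^sup>2 \<le> c * (\<bar>t\<bar> + \<bar>s\<bar>)\<^sup>2" by (intro mult_right_mono) auto
    from order_trans[OF this low[OF _ n True]] x show ?thesis by (intro min.coboundedI1) auto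
  next
    case False
    have "min c c' * sqrt x \<le> c' * sqrt x" using x by (intro mult_right_mono) auto
    from order_trans[OF this high[OF _ n _ T]] x False show ?thesis by (intro min.coboundedI2) auto
  qed
  moreover have "min c c' > 0" using c c' by simp
  ultimately show ?thesis by blast
qed

section \<open>Smoothing and characteristic functions\<close>

lemma (in pair_sigma_finite) integrable_mult_fst_snd:
  fixes f :: "'a \<Rightarrow> 'c::{real_normed_field, banach, second_countable_topology}"
  assumes f: "integrable M1 f" and g: "integrable M2 g"
  shows "integrable (M1 \<Otimes>\<^sub>M M2) (\<lambda>p. f (fst p) * g (snd p))"
proof (rule Fubini_integrable)
  show "(\<lambda>p. f (fst p) * g (snd p)) \<in> borel_measurable (M1 \<Otimes>\<^sub>M M2)"
    using f g by measurable
  show "integrable M1 (\<lambda>x. \<integral>y. norm (f (fst (x, y)) * g (snd (x, y))) \<partial>M2)"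
    using f by (simp add: norm_mult)
  show "AE x in M1. integrable M2 (\<lambda>y. f (fst (x, y)) * g (snd (x, y)))"
    using g by simp
qed

lemma (in pair_sigma_finite) integral_mult_fst_snd:
  fixes f :: "'a \<Rightarrow> 'c::{real_normed_field, banach, second_countable_topology}"
  assumes f: "integrable M1 f" and g: "integrable M2 g"
  shows "(\<integral>p. f (fst p) * g (snd p) \<partial>(M1 \<Otimes>\<^sub>M M2)) = (\<integral>x. f x \<partial>M1) * (\<integral>y. g y \<partial>M2)"
  using integral_fst'[OF integrable_mult_fst_snd[OF f g]] by simp

text \<open>The indicator of the ball is dominated by a Gaussian, which is itself the Fourier transform
  of the standard normal law in the plane. The tails of that law reach frequencies beyond
  \<open>1 / \<delta>\<close>, but contribute little.\<close>
lemma (in prob_space) prob_ball_le_char: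
  fixes X Y :: "'a \<Rightarrow> real"
  defines "G \<equiv> std_normal_distribution \<Otimes>\<^sub>M std_normal_distribution"
  assumes X[measurable]: "X \<in> borel_measurable M" and Y[measurable]: "Y \<in> borel_measurable M"
    and \<delta>: "\<delta> > 0"
  shows "prob {\<omega> \<in> space M. (X \<omega>, Y \<omega>) \<in> ball a \<delta>}
    \<le> exp (1 / 2) * (\<integral>p. cmod (\<integral>\<omega>. iexp (fst p / \<delta> * X \<omega> + snd p / \<delta> * Y \<omega>) \<partial>M) \<partial>G)"
proof -
  interpret N: real_distribution std_normal_distribution by (rule real_dist_normal_dist)
  interpret NN: pair_prob_space std_normal_distribution std_normal_distribution ..
  have G_prob: "prob_space G" unfolding G_def by (rule NN.P.prob_space_axioms)
  then interpret G: prob_space G .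
  interpret GM: pair_prob_space M G ..
  have [measurable_cong]: "sets G = sets (borel \<Otimes>\<^sub>M borel)"
    unfolding G_def by (intro sets_pair_measure_cong) auto
  obtain a1 a2 where a: "a = (a1, a2)" by (cases a)
  define U V where "U \<omega> = (X \<omega> - a1) / \<delta>" and "V \<omega> = (Y \<omega> - a2) / \<delta>" for \<omega>
  have [measurable]: "U \<in> borel_measurable M" "V \<in> borel_measurable M"
    unfolding U_def V_def by measurable
  \<comment> \<open>The two components are independent under \<open>G\<close>, so the transform is a
    product of two standard normal characteristic functions.\<close>
  have gauss: "complex_of_real (exp (- (u\<^sup>2 + v\<^sup>2) / 2)) = (\<integral>p. iexp (fst p * u + snd p * v) \<partial>G)"
    for u v :: real
  proof -
    have int: "integrable std_normal_distribution (\<lambda>x. iexp (x * w))" for w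
      by (rule N.integrable_iexp) auto
    have "(\<integral>p. iexp (fst p * u + snd p * v) \<partial>G) = (\<integral>p. iexp (fst p * u) * iexp (snd p * v) \<partial>G)"
      by (simp add: distrib_left flip: exp_add)
    also have "\<dots> = char std_normal_distribution u * char std_normal_distribution v"
      unfolding G_def char_def using NN.integral_mult_fst_snd[OF int[of u] int[of v]]
      by (simp add: mult.commute)
    also have "\<dots> = complex_of_real (exp (- (u\<^sup>2) / 2) * exp (- (v\<^sup>2) / 2))"
      unfolding char_std_normal_distribution by simp
    also have "exp (- (u\<^sup>2) / 2) * exp (- (v\<^sup>2) / 2) = exp (- (u\<^sup>2 + v\<^sup>2) / 2)"
      by (simp add: add_divide_distrib diff_divide_distrib flip: exp_add)
    finally show ?thesis by simp
  qed
  have [measurable]: "{\<omega> \<in> space M. (X \<omega>, Y \<omega>) \<in> ball a \<delta>} \<in> events"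
  proof -
    have "(\<lambda>\<omega>. (X \<omega>, Y \<omega>)) \<in> borel_measurable M"
      by (intro borel_measurable_Pair X Y)
    then have "(\<lambda>\<omega>. (X \<omega>, Y \<omega>)) -` ball a \<delta> \<inter> space M \<in> events"
      by (rule measurable_sets) simp
    then show ?thesis by (simp add: vimage_def Int_def conj_commute del: mem_ball)
  qed
  have int_exp: "integrable M (\<lambda>\<omega>. exp (- ((U \<omega>)\<^sup>2 + (V \<omega>)\<^sup>2) / 2))"
    by (rule integrable_const_bound[of _ 1]) auto
  have "prob {\<omega> \<in> space M. (X \<omega>, Y \<omega>) \<in> ball a \<delta>}
      = (\<integral>\<omega>. indicator {\<omega> \<in> space M. (X \<omega>, Y \<omega>) \<in> ball a \<delta>} \<omega> \<partial>M)"
    by simp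
  also have "\<dots> \<le> (\<integral>\<omega>. exp (1 / 2) * exp (- ((U \<omega>)\<^sup>2 + (V \<omega>)\<^sup>2) / 2) \<partial>M)"
  proof (rule integral_mono)
    show "integrable M (\<lambda>\<omega>. exp (1 / 2) * exp (- ((U \<omega>)\<^sup>2 + (V \<omega>)\<^sup>2) / 2))"
      using int_exp by simp
    fix \<omega>
    \<comment> \<open>On the ball the Gaussian is at least \<open>exp (- 1 / 2)\<close>, the source
      of the factor \<open>exp (1 / 2)\<close>.\<close>
    have "1 \<le> exp (1 / 2) * exp (- ((U \<omega>)\<^sup>2 + (V \<omega>)\<^sup>2) / 2)" if "(X \<omega>, Y \<omega>) \<in> ball a \<delta>"
    proof -
      have "sqrt ((a1 - X \<omega>)\<^sup>2 + (a2 - Y \<omega>)\<^sup>2) < \<delta>"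
        using that by (simp add: a dist_Pair_Pair dist_real_def)
      then have "(a1 - X \<omega>)\<^sup>2 + (a2 - Y \<omega>)\<^sup>2 \<le> \<delta>\<^sup>2"
        using \<delta> by (metis less_eq_real_def real_sqrt_le_iff real_sqrt_unique)
      then have "(U \<omega>)\<^sup>2 + (V \<omega>)\<^sup>2 \<le> 1"
        unfolding U_def V_def using \<delta>
        by (simp add: power_divide power2_commute flip: add_divide_distrib)
      then have "0 \<le> 1 / 2 + - ((U \<omega>)\<^sup>2 + (V \<omega>)\<^sup>2) / 2" by argo
      then show ?thesis unfolding exp_add[symmetric] by (simp only: one_le_exp_iff)
    qed
    then show "indicator {\<omega> \<in> space M. (X \<omega>, Y \<omega>) \<in> ball a \<delta>} \<omega>
        \<le> exp (1 / 2) * exp (- ((U \<omega>)\<^sup>2 + (V \<omega>)\<^sup>2) / 2)"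
      by (auto simp: indicator_def)
    show "integrable M (indicat_real {\<omega> \<in> space M. (X \<omega>, Y \<omega>) \<in> ball a \<delta>})"
      by (rule integrable_const_bound[of _ 1]) (auto simp del: mem_ball)
  qed
  also have "\<dots> = exp (1 / 2) * (\<integral>\<omega>. exp (- ((U \<omega>)\<^sup>2 + (V \<omega>)\<^sup>2) / 2) \<partial>M)"
    by simp
  also have "(\<integral>\<omega>. exp (- ((U \<omega>)\<^sup>2 + (V \<omega>)\<^sup>2) / 2) \<partial>M)
      \<le> (\<integral>p. cmod (\<integral>\<omega>. iexp (fst p / \<delta> * X \<omega> + snd p / \<delta> * Y \<omega>) \<partial>M) \<partial>G)"
  proof -
    let ?f = "\<lambda>\<omega> p. iexp (fst p * U \<omega> + snd p * V \<omega>)"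
    have int: "integrable (M \<Otimes>\<^sub>M G) (case_prod ?f)"
      unfolding case_prod_beta by (rule GM.P.integrable_iexp) auto
    have "complex_of_real (\<integral>\<omega>. exp (- ((U \<omega>)\<^sup>2 + (V \<omega>)\<^sup>2) / 2) \<partial>M)
        = (\<integral>\<omega>. (\<integral>p. ?f \<omega> p \<partial>G) \<partial>M)"
      by (simp only: gauss[symmetric] integral_complex_of_real)
    also have "\<dots> = (\<integral>p. (\<integral>\<omega>. ?f \<omega> p \<partial>M) \<partial>G)"
      by (rule GM.Fubini_integral[OF int, symmetric])
    finally have eq: "complex_of_real (\<integral>\<omega>. exp (- ((U \<omega>)\<^sup>2 + (V \<omega>)\<^sup>2) / 2) \<partial>M)
        = (\<integral>p. (\<integral>\<omega>. ?f \<omega> p \<partial>M) \<partial>G)" .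
    have "(\<integral>\<omega>. exp (- ((U \<omega>)\<^sup>2 + (V \<omega>)\<^sup>2) / 2) \<partial>M)
        \<le> cmod (complex_of_real (\<integral>\<omega>. exp (- ((U \<omega>)\<^sup>2 + (V \<omega>)\<^sup>2) / 2) \<partial>M))"
      by simp
    also have "\<dots> \<le> (\<integral>p. cmod (\<integral>\<omega>. ?f \<omega> p \<partial>M) \<partial>G)"
      unfolding eq by (rule integral_norm_bound)
    also have "(\<lambda>p. cmod (\<integral>\<omega>. ?f \<omega> p \<partial>M))
        = (\<lambda>p. cmod (\<integral>\<omega>. iexp (fst p / \<delta> * X \<omega> + snd p / \<delta> * Y \<omega>) \<partial>M))"
    proof (rule ext)
      fix p :: "real \<times> real"
      \<comment> \<open>The centre contributes a factor of modulus 1, so the bound is uniform in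
        \<open>a\<close>.\<close>
      have "?f \<omega> p = iexp (- (fst p * a1 + snd p * a2) / \<delta>) *
          iexp (fst p / \<delta> * X \<omega> + snd p / \<delta> * Y \<omega>)" for \<omega>
      proof -
        have "fst p * U \<omega> + snd p * V \<omega> = - (fst p * a1 + snd p * a2) / \<delta>
            + (fst p / \<delta> * X \<omega> + snd p / \<delta> * Y \<omega>)"
          unfolding U_def V_def using \<delta> by (simp add: field_simps)
        then show ?thesis by (simp only: of_real_add distrib_left exp_add)
      qed
      then have "(\<integral>\<omega>. ?f \<omega> p \<partial>M) = iexp (- (fst p * a1 + snd p * a2) / \<delta>) *
          (\<integral>\<omega>. iexp (fst p / \<delta> * X \<omega> + snd p / \<delta> * Y \<omega>) \<partial>M)"
        by (simp only: integral_mult_right_zero)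
      then show "cmod (\<integral>\<omega>. ?f \<omega> p \<partial>M) =
          cmod (\<integral>\<omega>. iexp (fst p / \<delta> * X \<omega> + snd p / \<delta> * Y \<omega>) \<partial>M)"
        by (simp only: norm_mult norm_exp_i_times mult_1)
    qed
    finally show ?thesis .
  qed
  finally show ?thesis by simp
qed

text \<open>The standard normal density is at most 1, and \<open>exp (- (c * x^2))\<close> is a
  multiple of the normal density of variance \<open>1 / (2 * c)\<close>. With \<open>c\<close> of
  order \<open>1 / \<delta>^2\<close>, two such factors will give \<open>\<delta>^2\<close>.\<close>

lemma integral_exp_sq_std_normal_le:
  fixes c :: real
  assumes "c > 0"
  shows "integrable std_normal_distribution (\<lambda>x. exp (- (c * x\<^sup>2)))"
    and "(\<integral>x. exp (- (c * x\<^sup>2)) \<partial>std_normal_distribution) \<le> sqrt (pi / c)"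
proof -
  interpret N: real_distribution std_normal_distribution by (rule real_dist_normal_dist)
  show "integrable std_normal_distribution (\<lambda>x. exp (- (c * x\<^sup>2)))"
    by (rule N.integrable_const_bound[of _ 1]) (use assms in auto)
  then have int: "integrable lborel (\<lambda>x. std_normal_density x * exp (- (c * x\<^sup>2)))"
    by (subst (asm) integrable_density) auto
  define \<sigma> where "\<sigma> = sqrt (1 / (2 * c))"
  have \<sigma>: "\<sigma> > 0" "\<sigma>\<^sup>2 = 1 / (2 * c)" using assms by (auto simp: \<sigma>_def)
  have eq: "exp (- (c * x\<^sup>2)) = sqrt (pi / c) * normal_density 0 \<sigma> x" for x
    unfolding normal_density_def \<sigma>(2) using assms by (simp add: real_sqrt_divide field_simps)
  have "(\<integral>x. exp (- (c * x\<^sup>2)) \<partial>std_normal_distribution)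
      = (\<integral>x. std_normal_density x * exp (- (c * x\<^sup>2)) \<partial>lborel)"
    by (subst integral_density) auto
  also have "\<dots> \<le> (\<integral>x. sqrt (pi / c) * normal_density 0 \<sigma> x \<partial>lborel)"
  proof (rule integral_mono[OF int])
    show "integrable lborel (\<lambda>x. sqrt (pi / c) * normal_density 0 \<sigma> x)"
      using \<sigma> by simp
    fix x :: real
    have "1 / sqrt (2 * pi) * exp (- x\<^sup>2 / 2) \<le> 1 * 1"
      using pi_gt3 by (intro mult_mono) (auto simp: real_le_rsqrt)
    then have "std_normal_density x \<le> 1" unfolding std_normal_density_def by simp
    then have "std_normal_density x * exp (- (c * x\<^sup>2)) \<le> 1 * exp (- (c * x\<^sup>2))"
      by (intro mult_right_mono) auto
    then show "std_normal_density x * exp (- (c * x\<^sup>2)) \<le> sqrt (pi / c) * normal_density 0 \<sigma> x"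
      unfolding eq[symmetric] by simp
  qed
  also have "\<dots> = sqrt (pi / c)" using \<sigma> by simp
  finally show "(\<integral>x. exp (- (c * x\<^sup>2)) \<partial>std_normal_distribution) \<le> sqrt (pi / c)" .
qed

section \<open>Symmetrization of characteristic functions\<close>

context real_distribution
begin

lemma integrable_bounded_borel:
  fixes f :: "real \<Rightarrow> real"
  assumes [measurable]: "f \<in> borel_measurable borel" and "\<And>x. \<bar>f x\<bar> \<le> B"
  shows "integrable M f"
  using assms by (intro integrable_const_bound[of _ B]) auto

text \<open>The addition formula writes the inner integral in terms of \<open>cos (u * x)\<close>
  and \<open>sin (u * x)\<close>, which also makes it integrable in \<open>x\<close>.\<close>

lemma integral_one_minus_cos:
  "(\<integral>y. 1 - cos (u * (x - y)) \<partial>M)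
    = 1 - (cos (u * x) * (\<integral>y. cos (u * y) \<partial>M) + sin (u * x) * (\<integral>y. sin (u * y) \<partial>M))"
proof -
  have [simp]: "integrable M (\<lambda>y. cos (u * y))" "integrable M (\<lambda>y. sin (u * y))"
    by (auto intro!: integrable_bounded_borel[of _ 1])
  have "(\<integral>y. 1 - cos (u * (x - y)) \<partial>M)
      = (\<integral>y. 1 - (cos (u * x) * cos (u * y) + sin (u * x) * sin (u * y)) \<partial>M)"
    by (simp add: right_diff_distrib cos_diff)
  also have "\<dots> = 1 - (cos (u * x) * (\<integral>y. cos (u * y) \<partial>M) + sin (u * x) * (\<integral>y. sin (u * y) \<partial>M))"
    by (subst Bochner_Integration.integral_diff) (simp_all add: prob_space del: space_eq_univ)
  finally show ?thesis .
qed

lemma integrable_integral_one_minus_cos: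
  "integrable M (\<lambda>x. \<integral>y. 1 - cos (u * (x - y)) \<partial>M)"
  unfolding integral_one_minus_cos
  by (intro Bochner_Integration.integrable_diff Bochner_Integration.integrable_add
      integrable_mult_left integrable_bounded_borel[of _ 1] integrable_const) auto

text \<open>\<open>(cmod (char M u))^2\<close> is the characteristic function of the difference of
  two independent copies, which is real.\<close>

lemma one_minus_cmod_char_sq:
  "1 - (cmod (char M u))\<^sup>2 = (\<integral>x. (\<integral>y. 1 - cos (u * (x - y)) \<partial>M) \<partial>M)"
proof -
  have [simp]: "integrable M (\<lambda>y. cos (u * y))" "integrable M (\<lambda>y. sin (u * y))"
    by (auto intro!: integrable_bounded_borel[of _ 1])
  have int: "integrable M (\<lambda>x. iexp (u * x))"
    by (rule integrable_iexp) auto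
  have "Re (char M u) = (\<integral>y. cos (u * y) \<partial>M)" "Im (char M u) = (\<integral>y. sin (u * y) \<partial>M)"
    unfolding char_def integral_Re[OF int, symmetric] integral_Im[OF int, symmetric]
    by (simp_all add: Re_exp Im_exp)
  then show ?thesis
    unfolding integral_one_minus_cos cmod_power2
    by (subst Bochner_Integration.integral_diff)
      (simp_all add: prob_space power2_eq_square del: space_eq_univ)
qed

text \<open>The integrand of the symmetrized formula is nonnegative, so only the pairs in
  \<open>A\<close> times \<open>B\<close> are kept. The lower bound is asked of the whole sum, since
  no single term is controlled.\<close>

lemma sum_one_minus_cmod_char_sq_ge:
  fixes v :: "'i \<Rightarrow> real"
  assumes [measurable]: "A \<in> sets borel" "B \<in> sets borel" and "finite I"
    and sep: "\<And>x y. x \<in> A \<Longrightarrow> y \<in> B \<Longrightarrow> g \<le> (\<Sum>i\<in>I. 1 - cos (v i * (x - y)))" and "0 \<le> g"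
  shows "prob A * prob B * g \<le> (\<Sum>i\<in>I. 1 - (cmod (char M (v i)))\<^sup>2)"
proof -
  have int: "integrable M (\<lambda>y. 1 - cos (u * (x - y)))" for u x
  proof (rule integrable_bounded_borel[of _ 2])
    show "\<bar>1 - cos (u * (x - y))\<bar> \<le> 2" for y
      using cos_ge_minus_one[of "u * (x - y)"] cos_le_one[of "u * (x - y)"] by linarith
  qed simp
  have ind: "integrable M (\<lambda>y. indicat_real S y * c)" if "S \<in> sets borel" for S c
    using that by (intro integrable_mult_left integrable_bounded_borel[of _ 1]) (auto simp: indicator_def)
  have "prob A * prob B * g = (\<integral>x. indicat_real A x * (\<integral>y. indicat_real B y * g \<partial>M) \<partial>M)"
    by simp
  also have "\<dots> \<le> (\<integral>x. (\<Sum>i\<in>I. \<integral>y. 1 - cos (v i * (x - y)) \<partial>M) \<partial>M)"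
  proof (rule integral_mono)
    show "integrable M (\<lambda>x. indicat_real A x * (\<integral>y. indicat_real B y * g \<partial>M))"
      by (rule ind) simp
    show "integrable M (\<lambda>x. \<Sum>i\<in>I. \<integral>y. 1 - cos (v i * (x - y)) \<partial>M)"
      by (intro Bochner_Integration.integrable_sum integrable_integral_one_minus_cos)
    fix x
    have sum_eq: "(\<Sum>i\<in>I. \<integral>y. 1 - cos (v i * (x - y)) \<partial>M) = (\<integral>y. (\<Sum>i\<in>I. 1 - cos (v i * (x - y))) \<partial>M)"
      by (rule Bochner_Integration.integral_sum[symmetric]) (rule int)
    have "indicat_real A x * (\<integral>y. indicat_real B y * g \<partial>M) = (\<integral>y. indicat_real A x * (indicat_real B y * g) \<partial>M)"
      by simp
    also have "\<dots> \<le> (\<integral>y. (\<Sum>i\<in>I. 1 - cos (v i * (x - y))) \<partial>M)"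
    proof (rule integral_mono)
      show "integrable M (\<lambda>y. indicat_real A x * (indicat_real B y * g))"
        by (intro integrable_mult_right ind) simp
      show "integrable M (\<lambda>y. \<Sum>i\<in>I. 1 - cos (v i * (x - y)))"
        by (intro Bochner_Integration.integrable_sum int)
      show "indicat_real A x * (indicat_real B y * g) \<le> (\<Sum>i\<in>I. 1 - cos (v i * (x - y)))" for y
        using sep[of x y] by (auto simp: indicator_def intro!: sum_nonneg)
    qed
    finally show "indicat_real A x * (\<integral>y. indicat_real B y * g \<partial>M)
        \<le> (\<Sum>i\<in>I. \<integral>y. 1 - cos (v i * (x - y)) \<partial>M)"
      unfolding sum_eq .
  qed
  also have "\<dots> = (\<Sum>i\<in>I. 1 - (cmod (char M (v i)))\<^sup>2)"
    unfolding one_minus_cmod_char_sq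
    by (rule Bochner_Integration.integral_sum) (rule integrable_integral_one_minus_cos)
  finally show ?thesis .
qed

text \<open>From \<open>1 + v <= exp v\<close> with \<open>v = (cmod (char M u))^2 - 1\<close>. For
  infinite \<open>I\<close> the product is 1 and the sum 0 by convention, so both sides are
  1.\<close>

lemma prod_cmod_char_le:
  fixes v :: "'i \<Rightarrow> real"
  shows "(\<Prod>i\<in>I. cmod (char M (v i))) \<le> exp (- (\<Sum>i\<in>I. 1 - (cmod (char M (v i)))\<^sup>2) / 2)"
proof (cases "finite I")
  case True
  have "cmod (char M u) \<le> exp (- (1 - (cmod (char M u))\<^sup>2) / 2)" for u
  proof -
    have "(cmod (char M u))\<^sup>2 \<le> exp (- (1 - (cmod (char M u))\<^sup>2))"
      using exp_ge_add_one_self[of "- (1 - (cmod (char M u))\<^sup>2)"] by simp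
    also have "\<dots> = (exp (- (1 - (cmod (char M u))\<^sup>2) / 2))\<^sup>2"
      by (simp add: exp_double[symmetric])
    finally show ?thesis by (rule power2_le_imp_le) simp
  qed
  then have "(\<Prod>i\<in>I. cmod (char M (v i))) \<le> (\<Prod>i\<in>I. exp (- (1 - (cmod (char M (v i)))\<^sup>2) / 2))"
    by (intro prod_mono) auto
  also have "\<dots> = exp (\<Sum>i\<in>I. - (1 - (cmod (char M (v i)))\<^sup>2) / 2)"
    using True by (simp only: exp_sum)
  also have "(\<Sum>i\<in>I. - (1 - (cmod (char M (v i)))\<^sup>2) / 2)
      = - (\<Sum>i\<in>I. 1 - (cmod (char M (v i)))\<^sup>2) / 2"
    by (simp only: sum_negf flip: sum_divide_distrib)
  finally show ?thesis .
qed simp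

text \<open>A nonzero law of mean 0 charges both half-lines. Both are cut off near 0 and near
  infinity; the upper bound \<open>\<beta>\<close> will keep the rescaled frequencies polynomial in
  \<open>x\<close>.\<close>

lemma exists_separated_sets:
  assumes int: "integrable M (\<lambda>x. x)" and mean: "(\<integral>x. x \<partial>M) = 0" and nz: "\<not> (AE x in M. x = 0)"
  shows "\<exists>A B \<alpha> \<beta>. A \<in> sets borel \<and> B \<in> sets borel \<and> 0 < prob A \<and> 0 < prob B \<and> 0 < \<alpha> \<and>
    (\<forall>x\<in>A. \<forall>y\<in>B. \<alpha> \<le> x - y \<and> x - y \<le> \<beta>)"
proof -
  have ex: "\<exists>n::nat. 0 < prob {x. 1 / real (Suc n) \<le> \<sigma> * x \<and> \<sigma> * x \<le> real (Suc n)}"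
    if \<sigma>: "\<sigma> \<noteq> 0" for \<sigma> :: real
  proof (rule ccontr)
    assume neg: "\<not> ?thesis"
    have "AE x in M. \<forall>n::nat. \<not> (1 / real (Suc n) \<le> \<sigma> * x \<and> \<sigma> * x \<le> real (Suc n))"
      unfolding AE_all_countable
    proof
      fix n :: nat
      have "prob {x. 1 / real (Suc n) \<le> \<sigma> * x \<and> \<sigma> * x \<le> real (Suc n)} = 0"
        using neg measure_nonneg[of M] by (metis less_eq_real_def)
      then show "AE x in M. \<not> (1 / real (Suc n) \<le> \<sigma> * x \<and> \<sigma> * x \<le> real (Suc n))"
        by (subst (asm) prob_eq_0) auto
    qed
    \<comment> \<open>If no piece is charged, \<open>- (\<sigma> * x)\<close> is nonnegative almost
      everywhere with mean 0, hence 0 almost everywhere.\<close>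
    then have "AE x in M. 0 \<le> - (\<sigma> * x)"
    proof (rule eventually_mono, intro ccontr[of "0 \<le> _"])
      fix x assume x: "\<forall>n::nat. \<not> (1 / real (Suc n) \<le> \<sigma> * x \<and> \<sigma> * x \<le> real (Suc n))"
        and "\<not> 0 \<le> - (\<sigma> * x)"
      then have pos: "0 < \<sigma> * x" by simp
      obtain m where m: "inverse (real (Suc m)) < \<sigma> * x" using reals_Archimedean[OF pos] by blast
      obtain k :: nat where k: "\<sigma> * x \<le> real k" using real_arch_simple by blast
      have "1 / real (Suc (m + k)) \<le> 1 / real (Suc m)" by (intro divide_left_mono) auto
      then show False using x[rule_format, of "m + k"] m k by (simp add: inverse_eq_divide)
    qed
    moreover have "integrable M (\<lambda>x. - (\<sigma> * x))" "(\<integral>x. - (\<sigma> * x) \<partial>M) = 0"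
      using int mean by simp_all
    ultimately have "AE x in M. - (\<sigma> * x) = 0"
      using integral_nonneg_eq_0_iff_AE by blast
    then show False using nz \<sigma> by simp
  qed
  obtain n where n: "0 < prob {x. 1 / real (Suc n) \<le> 1 * x \<and> 1 * x \<le> real (Suc n)}"
    using ex[of 1] by auto
  obtain m where m: "0 < prob {x. 1 / real (Suc m) \<le> (- 1) * x \<and> (- 1) * x \<le> real (Suc m)}"
    using ex[of "- 1"] by auto
  show ?thesis
  proof (intro exI conjI ballI)
    fix x y :: real
    assume "x \<in> {x. 1 / real (Suc n) \<le> 1 * x \<and> 1 * x \<le> real (Suc n)}"
      and "y \<in> {x. 1 / real (Suc m) \<le> (- 1) * x \<and> (- 1) * x \<le> real (Suc m)}"
    then have xy: "1 / real (Suc n) \<le> x" "x \<le> real (Suc n)" "1 / real (Suc m) \<le> - y"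
      "- y \<le> real (Suc m)" by simp_all
    then show "1 / real (Suc n) + 1 / real (Suc m) \<le> x - y" "x - y \<le> real (Suc n) + real (Suc m)"
      by linarith+
  qed (use n m in \<open>auto intro!: add_pos_pos\<close>)
qed

end

section \<open>The small ball estimate\<close>

text \<open>A separation \<open>\<tau>\<close> between two copies replaces \<open>(t, s)\<close> by
  \<open>(\<tau> * t, \<tau> * s)\<close>, so the cosine bound applies to each pair in
  \<open>A\<close> times \<open>B\<close>. The minimum in the exponent becomes a sum of two
  exponentials.\<close>

lemma prod_cmod_char_coord_le:
  assumes "real_distribution D" and "integrable D (\<lambda>x. x)" and "(\<integral>x. x \<partial>D) = 0"
    and "\<not> (AE x in D. x = 0)"
  shows "\<exists>c>0. \<exists>X0. \<forall>x\<ge>X0. \<forall>n t s. x\<^sup>2 \<le> real n \<and> \<bar>t\<bar> + \<bar>s\<bar> \<le> x ^ p \<longrightarrow>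
    (\<Prod>i=1..n. cmod (char D (coord x t s i)))
      \<le> exp (- (c * t\<^sup>2)) * exp (- (c * s\<^sup>2)) + exp (- (c * sqrt x))"
proof -
  interpret real_distribution D by fact
  obtain A B \<alpha> \<beta> where AB: "A \<in> sets borel" "B \<in> sets borel" "0 < prob A" "0 < prob B"
    "0 < \<alpha>" "\<And>x y. x \<in> A \<Longrightarrow> y \<in> B \<Longrightarrow> \<alpha> \<le> x - y \<and> x - y \<le> \<beta>"
    using exists_separated_sets[OF assms(2-4)] by blast
  \<comment> \<open>The exponent \<open>p + 1\<close> absorbs the factor
    \<open>\<tau> \<le> \<beta> \<le> x\<close>.\<close>
  obtain c X0 where c: "c > 0" and X0: "\<And>x n t s. x \<ge> X0 \<Longrightarrow> x\<^sup>2 \<le> real n \<Longrightarrow>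
      \<bar>t\<bar> + \<bar>s\<bar> \<le> x ^ (p + 1) \<Longrightarrow>
      min (c * (\<bar>t\<bar> + \<bar>s\<bar>)\<^sup>2) (c * sqrt x) \<le> (\<Sum>i=1..n. 1 - cos (coord x t s i))"
    using sum_cos_coord_ge[of "p + 1"] by blast
  define \<kappa> where "\<kappa> = prob A * prob B / 2"
  have \<kappa>: "\<kappa> > 0" using AB by (simp add: \<kappa>_def)
  define c' where "c' = \<kappa> * c * min (\<alpha>\<^sup>2) 1"
  have c'0: "c' > 0" using \<kappa> c AB(5) by (simp add: c'_def)
  have "(\<Prod>i=1..n. cmod (char D (coord x t s i)))
      \<le> exp (- (c' * t\<^sup>2)) * exp (- (c' * s\<^sup>2)) + exp (- (c' * sqrt x))"
    if x: "x \<ge> max (max X0 \<beta>) 1" and n: "x\<^sup>2 \<le> real n" and ts: "\<bar>t\<bar> + \<bar>s\<bar> \<le> x ^ p" for x n t s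
  proof -
    define T where "T = \<bar>t\<bar> + \<bar>s\<bar>"
    define g where "g = min (c * (\<alpha> * T)\<^sup>2) (c * sqrt x)"
    have g0: "0 \<le> g" using c x by (simp add: g_def)
    have sep: "g \<le> (\<Sum>i=1..n. 1 - cos (coord x t s i * (a - b)))" if ab: "a \<in> A" "b \<in> B" for a b
    proof -
      define \<tau> where "\<tau> = a - b"
      have \<tau>: "\<alpha> \<le> \<tau>" "\<tau> \<le> \<beta>" "0 < \<tau>" using AB(5,6) ab by (force simp: \<tau>_def)+
      have T\<tau>: "\<bar>\<tau> * t\<bar> + \<bar>\<tau> * s\<bar> = \<tau> * T" using \<tau>(3) by (simp add: T_def abs_mult distrib_left)
      have "\<tau> * T \<le> x * x ^ p" using \<tau> x ts unfolding T_def by (intro mult_mono) auto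
      then have "min (c * (\<tau> * T)\<^sup>2) (c * sqrt x) \<le> (\<Sum>i=1..n. 1 - cos (coord x (\<tau> * t) (\<tau> * s) i))"
        using X0[of x n "\<tau> * t" "\<tau> * s"] x n unfolding T\<tau> by simp
      moreover have coord_eq: "coord x (\<tau> * t) (\<tau> * s) i = coord x t s i * \<tau>" for i
        by (simp add: coord_def algebra_simps)
      ultimately have "min (c * (\<tau> * T)\<^sup>2) (c * sqrt x) \<le> (\<Sum>i=1..n. 1 - cos (coord x t s i * \<tau>))"
        by (simp only: coord_eq)
      moreover have "(\<alpha> * T)\<^sup>2 \<le> (\<tau> * T)\<^sup>2"
        using \<tau> AB(5) by (intro power_mono mult_right_mono) (auto simp: T_def)
      then have "g \<le> min (c * (\<tau> * T)\<^sup>2) (c * sqrt x)"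
        unfolding g_def using c by (intro min.mono) auto
      ultimately show ?thesis unfolding \<tau>_def by (meson order_trans)
    qed
    have "(\<Prod>i=1..n. cmod (char D (coord x t s i)))
        \<le> exp (- (\<Sum>i=1..n. 1 - (cmod (char D (coord x t s i)))\<^sup>2) / 2)"
      by (rule prod_cmod_char_le)
    also have "\<dots> \<le> exp (- (prob A * prob B * g) / 2)"
      using sum_one_minus_cmod_char_sq_ge[OF AB(1,2) _ sep g0] by simp
    also have "\<dots> = exp (- (\<kappa> * g))" by (simp add: \<kappa>_def)
    also have "\<dots> \<le> exp (- (c' * (t\<^sup>2 + s\<^sup>2))) + exp (- (c' * sqrt x))"
    proof -
      have T2: "t\<^sup>2 + s\<^sup>2 \<le> T\<^sup>2"
        unfolding T_def by (simp add: power2_sum)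
      have "c' * (t\<^sup>2 + s\<^sup>2) \<le> (\<kappa> * c * \<alpha>\<^sup>2) * T\<^sup>2"
        using T2 \<kappa> c unfolding c'_def by (intro mult_mono) auto
      moreover have "c' * sqrt x \<le> (\<kappa> * c * 1) * sqrt x"
        using \<kappa> c x unfolding c'_def by (intro mult_right_mono mult_left_mono) auto
      ultimately have "c' * (t\<^sup>2 + s\<^sup>2) \<le> \<kappa> * g \<or> c' * sqrt x \<le> \<kappa> * g"
        unfolding g_def min_def by (auto simp: power_mult_distrib mult_ac)
      then have "exp (- (\<kappa> * g)) \<le> exp (- (c' * (t\<^sup>2 + s\<^sup>2))) \<or> exp (- (\<kappa> * g)) \<le> exp (- (c' * sqrt x))"
        by auto
      then show ?thesis
        using exp_ge_zero[of "- (c' * (t\<^sup>2 + s\<^sup>2))"] exp_ge_zero[of "- (c' * sqrt x)"] by linarith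
    qed
    also have "exp (- (c' * (t\<^sup>2 + s\<^sup>2))) = exp (- (c' * t\<^sup>2)) * exp (- (c' * s\<^sup>2))"
      by (simp add: distrib_left flip: exp_add)
    finally show ?thesis .
  qed
  then show ?thesis using c'0 by blast
qed

lemma scaled_Sn:
  assumes "N > 0"
  shows "(1 / sqrt N) *\<^sub>R Sn N n x \<xi>
    = (\<Sum>i=1..n. \<xi> i * wt x i, \<Sum>i=1..n. \<xi> i * (wt x i * ((real i - x\<^sup>2) / x)))"
proof -
  have "bfun N i x = sqrt N * wt x i" "cfun N i x = sqrt N * (wt x i * ((real i - x\<^sup>2) / x))" for i
    by (simp_all add: bfun_def cfun_def wt_def mult_ac)
  moreover have "1 / sqrt N * (u * (sqrt N * v)) = u * v" for u v
    using assms by simp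
  ultimately show ?thesis
    by (simp only: Sn_def sum_prod scaleR_Pair real_scaleR_def sum_distrib_left)
qed

text \<open>After smoothing, independence factors the characteristic function of the sum.\<close>

lemma prob_Sn_ball_le:
  fixes D :: "real measure" and N x \<delta> :: real and n :: nat
  assumes D: "real_distribution D" and N: "N > 0" and \<delta>: "\<delta> > 0"
  shows "measure (PiM {1..n} (\<lambda>_. D))
      {\<xi> \<in> space (PiM {1..n} (\<lambda>_. D)). (1 / sqrt N) *\<^sub>R Sn N n x \<xi> \<in> ball a \<delta>}
    \<le> exp (1 / 2) * (\<integral>p. (\<Prod>i=1..n. cmod (char D (coord x (fst p / \<delta>) (snd p / \<delta>) i)))
        \<partial>(std_normal_distribution \<Otimes>\<^sub>M std_normal_distribution))"
proof -
  interpret D: real_distribution D by fact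
  interpret product_prob_space "\<lambda>_. D" "{1..n}" ..
  let ?M = "PiM {1..n} (\<lambda>_. D)"
  have M: "prob_space ?M" by (rule prob_space_PiM) (rule D.prob_space_axioms)
  define X where "X \<xi> = (\<Sum>i=1..n. \<xi> i * wt x i)" for \<xi> :: "nat \<Rightarrow> real"
  define Y where "Y \<xi> = (\<Sum>i=1..n. \<xi> i * (wt x i * ((real i - x\<^sup>2) / x)))" for \<xi> :: "nat \<Rightarrow> real"
  have meas: "(\<lambda>\<xi>. \<xi> i) \<in> borel_measurable ?M" if "i \<in> {1..n}" for i
    using measurable_component_singleton[OF that, of "\<lambda>_. D"]
      measurable_cong_sets[OF refl D.events_eq_borel, of ?M] by auto
  have "X \<in> borel_measurable ?M" "Y \<in> borel_measurable ?M"
    unfolding X_def Y_def by (intro borel_measurable_sum borel_measurable_times meas borel_measurable_const; simp)+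
  from prob_space.prob_ball_le_char[OF M this \<delta>, of a]
  have "measure ?M {\<xi> \<in> space ?M. (X \<xi>, Y \<xi>) \<in> ball a \<delta>}
    \<le> exp (1 / 2) * (\<integral>p. cmod (\<integral>\<xi>. iexp (fst p / \<delta> * X \<xi> + snd p / \<delta> * Y \<xi>) \<partial>?M)
        \<partial>(std_normal_distribution \<Otimes>\<^sub>M std_normal_distribution))" .
  moreover have "(1 / sqrt N) *\<^sub>R Sn N n x \<xi> = (X \<xi>, Y \<xi>)" for \<xi>
    unfolding scaled_Sn[OF N] X_def Y_def ..
  moreover have "cmod (\<integral>\<xi>. iexp (t * X \<xi> + s * Y \<xi>) \<partial>?M)
      = (\<Prod>i=1..n. cmod (char D (coord x t s i)))" for t s
  proof -
    have "t * X \<xi> + s * Y \<xi> = (\<Sum>i=1..n. coord x t s i * \<xi> i)" for \<xi>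
      unfolding X_def Y_def sum_distrib_left coord_def
      by (simp add: algebra_simps flip: sum.distrib)
    then have "iexp (t * X \<xi> + s * Y \<xi>) = (\<Prod>i=1..n. iexp (coord x t s i * \<xi> i))" for \<xi>
      by (simp only: of_real_sum sum_distrib_left exp_sum finite_atLeastAtMost)
    then have "(\<integral>\<xi>. iexp (t * X \<xi> + s * Y \<xi>) \<partial>?M) = (\<integral>\<xi>. (\<Prod>i=1..n. iexp (coord x t s i * \<xi> i)) \<partial>?M)"
      by simp
    also have "\<dots> = (\<Prod>i=1..n. \<integral>y. iexp (coord x t s i * y) \<partial>D)"
      by (rule product_integral_prod) (auto intro!: D.integrable_iexp)
    finally show ?thesis by (simp only: prod_norm char_def)
  qed
  ultimately show ?thesis by (simp only:)
qed

lemma exp_neg_sqrt_le_powr: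
  fixes c C :: real
  assumes "c > 0" "C > 0"
  shows "\<exists>N0. \<forall>N\<ge>N0. exp (- (c * sqrt N)) \<le> (N powr (- C))\<^sup>2"
proof (intro exI allI impI)
  \<comment> \<open>Beyond this threshold \<open>8 * C * N powr (1 / 4)\<close> is at most
    \<open>c * sqrt N\<close>, while \<open>ln N\<close> is at most
    \<open>4 * N powr (1 / 4)\<close>.\<close>
  fix N assume N: "N \<ge> max 1 ((8 * C / c) ^ 4)"
  have N1: "N \<ge> 1" using N by simp
  have "8 * C / c = ((8 * C / c) ^ 4) powr (1 / 4)"
    using assms by (simp add: powr_powr flip: powr_numeral)
  also have "\<dots> \<le> N powr (1 / 4)" using N by (intro powr_mono2) auto
  finally have "8 * C \<le> c * N powr (1 / 4)" using assms by (simp add: field_simps)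
  then have "8 * C * N powr (1 / 4) \<le> c * N powr (1 / 4) * N powr (1 / 4)"
    by (intro mult_right_mono) auto
  also have "\<dots> = c * sqrt N"
    using N1 by (simp add: powr_half_sqrt mult.assoc flip: powr_add)
  finally have "8 * C * N powr (1 / 4) \<le> c * sqrt N" .
  moreover have "ln N \<le> N powr (1 / 4) / (1 / 4)" using N1 by (intro ln_powr_bound) auto
  then have "2 * C * ln N \<le> 2 * C * (N powr (1 / 4) / (1 / 4))"
    using assms by (intro mult_left_mono) auto
  ultimately have "2 * C * ln N \<le> c * sqrt N" by simp
  then have "exp (- (c * sqrt N)) \<le> exp (- (2 * C * ln N))" by simp
  also have "\<dots> = (N powr (- C))\<^sup>2"
    using N1 by (simp add: powr_def exp_double[symmetric])
  finally show "exp (- (c * sqrt N)) \<le> (N powr (- C))\<^sup>2" .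
qed

text \<open>The exponentials separate into a product of one-dimensional integrals; the moment terms
  serve where a coordinate is large.\<close>

lemma integral_std_normal_pair_le:
  fixes F :: "real \<times> real \<Rightarrow> real"
  assumes c: "c > 0" and \<kappa>: "0 \<le> \<kappa>" and b: "0 \<le> b"
    and F: "\<And>p. F p \<le> exp (- (c * (fst p)\<^sup>2)) * exp (- (c * (snd p)\<^sup>2)) + \<kappa>
      + b * (fst p) ^ (2 * q) + b * (snd p) ^ (2 * q)"
  shows "(\<integral>p. F p \<partial>(std_normal_distribution \<Otimes>\<^sub>M std_normal_distribution))
    \<le> pi / c + \<kappa> + 2 * b * (\<integral>x. x ^ (2 * q) \<partial>std_normal_distribution)"
proof -
  interpret N: real_distribution std_normal_distribution by (rule real_dist_normal_dist)
  interpret NN: pair_prob_space std_normal_distribution std_normal_distribution ..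
  let ?\<gamma> = std_normal_distribution
  let ?u = "\<lambda>x. exp (- (c * x\<^sup>2))" and ?m = "\<lambda>x. b * x ^ (2 * q)"
  note u = integral_exp_sq_std_normal_le[OF c]
  have m: "integrable ?\<gamma> ?m"
    using std_normal_distribution_even_moments(2)[of q] by simp
  have one: "integrable ?\<gamma> (\<lambda>x. 1 :: real)" by simp
  note int = NN.integrable_mult_fst_snd[OF u(1) u(1)] NN.integrable_mult_fst_snd[OF m one]
    NN.integrable_mult_fst_snd[OF one m]
  note val = NN.integral_mult_fst_snd[OF u(1) u(1)] NN.integral_mult_fst_snd[OF m one]
    NN.integral_mult_fst_snd[OF one m]
  let ?H = "\<lambda>p. ?u (fst p) * ?u (snd p) + \<kappa> + ?m (fst p) * 1 + 1 * ?m (snd p)"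
  have int_H: "integrable (?\<gamma> \<Otimes>\<^sub>M ?\<gamma>) ?H"
    by (intro Bochner_Integration.integrable_add int NN.P.integrable_const)
  have "(\<integral>p. F p \<partial>(?\<gamma> \<Otimes>\<^sub>M ?\<gamma>)) \<le> (\<integral>p. ?H p \<partial>(?\<gamma> \<Otimes>\<^sub>M ?\<gamma>))"
  \<comment> \<open>If \<open>F\<close> is not integrable its integral is 0 by convention, a case
    covered by the nonnegativity of \<open>?H\<close>.\<close>
  proof (rule integral_mono'[OF int_H])
    show "F p \<le> ?H p" for p using F[of p] by simp
    show "0 \<le> ?H p" for p using \<kappa> b by (intro add_nonneg_nonneg mult_nonneg_nonneg) auto
  qed
  also have "\<dots> = (\<integral>x. ?u x \<partial>?\<gamma>) * (\<integral>x. ?u x \<partial>?\<gamma>) + \<kappa> + (\<integral>x. ?m x \<partial>?\<gamma>) + (\<integral>x. ?m x \<partial>?\<gamma>)"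
  proof -
    have "(\<integral>p. \<kappa> \<partial>(?\<gamma> \<Otimes>\<^sub>M ?\<gamma>)) = \<kappa>" "(\<integral>x. 1 \<partial>?\<gamma>) = (1 :: real)"
      using NN.P.prob_space N.prob_space by simp_all
    then show ?thesis
      by (simp only: Bochner_Integration.integral_add Bochner_Integration.integrable_add int
          NN.P.integrable_const val)
  qed
  also have "\<dots> \<le> sqrt (pi / c) * sqrt (pi / c) + \<kappa> + (\<integral>x. ?m x \<partial>?\<gamma>) + (\<integral>x. ?m x \<partial>?\<gamma>)"
    using u(2) c by (intro add_right_mono mult_mono) (auto intro!: integral_nonneg_AE)
  also have "\<dots> = pi / c + \<kappa> + 2 * b * (\<integral>x. x ^ (2 * q) \<partial>?\<gamma>)"
    using c by simp
  finally show ?thesis .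
qed

text \<open>While both normal coordinates are at most \<open>N\<close> in absolute value, the
  frequencies stay below a power of \<open>x\<close> and the product bound applies. Beyond that the
  product is at most 1, which a moment of order \<open>2 * q\<close> dominates, as in Markov's
  inequality.\<close>

lemma small_ball:
  fixes C a1 a2 :: real and D :: "real measure"
  assumes C: "C > 0" and a1: "a1 > 0"
    and D: "real_distribution D" "integrable D (\<lambda>x. x)" "(\<integral>x. x \<partial>D) = 0" "\<not> (AE x in D. x = 0)"
  shows "\<exists>K N0. \<forall>N n x a. N \<ge> N0 \<and> a1 * N \<le> x \<and> x\<^sup>2 \<le> real n \<longrightarrow>
    measure (PiM {1..n} (\<lambda>_. D))
      {\<xi> \<in> space (PiM {1..n} (\<lambda>_. D)). (1 / sqrt N) *\<^sub>R Sn N n x \<xi> \<in> ball a (N powr (- C))}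
    \<le> K * (N powr (- C))\<^sup>2"
proof -
  interpret D: real_distribution D by fact
  \<comment> \<open>As \<open>q >= C + 1\<close>, one has \<open>N / \<delta> \<le> N ^ q\<close>
    and \<open>1 / N ^ (2 * q) \<le> \<delta>^2\<close>.\<close>
  define q where "q = nat \<lceil>C\<rceil> + 1"
  have q: "C + 1 \<le> real q" using C unfolding q_def by linarith
  \<comment> \<open>One more power of \<open>x\<close> absorbs the constant
    \<open>2 * (1 / a1) ^ q\<close>.\<close>
  define r where "r = q + 1"
  obtain c X0 where c: "c > 0" and X0: "\<And>x n t s. x \<ge> X0 \<Longrightarrow> x\<^sup>2 \<le> real n \<Longrightarrow> \<bar>t\<bar> + \<bar>s\<bar> \<le> x ^ r \<Longrightarrow>
    (\<Prod>i=1..n. cmod (char D (coord x t s i)))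
      \<le> exp (- (c * t\<^sup>2)) * exp (- (c * s\<^sup>2)) + exp (- (c * sqrt x))"
    using prod_cmod_char_coord_le[OF D, of r] by blast
  obtain N1 where N1: "\<And>N. N \<ge> N1 \<Longrightarrow> exp (- (c * sqrt a1 * sqrt N)) \<le> (N powr (- C))\<^sup>2"
    using exp_neg_sqrt_le_powr[of "c * sqrt a1" C] c a1 C by auto
  define m where "m = (\<integral>x. x ^ (2 * q) \<partial>std_normal_distribution)"
  have m: "m \<ge> 0" unfolding m_def by (intro integral_nonneg_AE) auto
  define K where "K = exp (1 / 2) * (pi / c + 1 + 2 * m)"
  define N0 where "N0 = max 1 (max N1 (max X0 (2 * (1 / a1) ^ q) / a1))"
  have "measure (PiM {1..n} (\<lambda>_. D))
      {\<xi> \<in> space (PiM {1..n} (\<lambda>_. D)). (1 / sqrt N) *\<^sub>R Sn N n x \<xi> \<in> ball a (N powr (- C))}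
    \<le> K * (N powr (- C))\<^sup>2"
    if NN: "N \<ge> N0" and x: "a1 * N \<le> x" and n: "x\<^sup>2 \<le> real n" for N n x a
  proof -
    have N: "N \<ge> 1" "N \<ge> N1" "max X0 (2 * (1 / a1) ^ q) / a1 \<le> N"
      using NN by (auto simp: N0_def)
    have "max X0 (2 * (1 / a1) ^ q) \<le> x"
      using N(3) x a1 by (simp add: pos_divide_le_eq mult.commute)
    then have xX: "X0 \<le> x" "2 * (1 / a1) ^ q \<le> x" by auto
    have x0: "x > 0" using x a1 N by (meson less_le_trans mult_pos_pos zero_less_one)
    define \<delta> where "\<delta> = N powr (- C)"
    have \<delta>: "\<delta> > 0" using N by (simp add: \<delta>_def)
    define F where "F p = (\<Prod>i=1..n. cmod (char D (coord x (fst p / \<delta>) (snd p / \<delta>) i)))"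
      for p :: "real \<times> real"
    define \<kappa> where "\<kappa> = exp (- (c * sqrt x))"
    define b where "b = 1 / N ^ (2 * q)"
    have "sqrt a1 * sqrt N \<le> sqrt x" using x by (simp flip: real_sqrt_mult)
    then have "exp (- (c * sqrt x)) \<le> exp (- (c * sqrt a1 * sqrt N))"
      using c by (simp add: mult.assoc)
    from order_trans[OF this N1[OF N(2)]]
    have \<kappa>: "0 \<le> \<kappa>" "\<kappa> \<le> \<delta>\<^sup>2" by (simp_all add: \<kappa>_def \<delta>_def)
    have Nq: "1 / \<delta> * N \<le> N ^ q" "1 / N ^ q \<le> \<delta>"
    proof -
      have "1 / \<delta> * N = N powr (C + 1)"
        using N by (simp add: \<delta>_def powr_minus powr_add inverse_eq_divide)
      also have "\<dots> \<le> N powr real q" using q N by (intro powr_mono) auto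
      also have Nq: "N powr real q = N ^ q" using N by (simp add: powr_realpow)
      finally show "1 / \<delta> * N \<le> N ^ q" .
      have "1 / N ^ q = N powr (- real q)"
        unfolding powr_minus Nq by (simp add: inverse_eq_divide)
      also have "\<dots> \<le> \<delta>" unfolding \<delta>_def using q N by (intro powr_mono) auto
      finally show "1 / N ^ q \<le> \<delta>" .
    qed
    have b: "0 \<le> b" "b \<le> \<delta>\<^sup>2"
    proof -
      have "b = (1 / N ^ q)\<^sup>2"
        by (simp add: b_def power_divide mult.commute flip: power_mult)
      also have "\<dots> \<le> \<delta>\<^sup>2" using Nq(2) N by (intro power_mono) auto
      finally show "b \<le> \<delta>\<^sup>2" .
    qed (use N in \<open>simp add: b_def\<close>)
    have F_le: "F p \<le> exp (- ((c / \<delta>\<^sup>2) * (fst p)\<^sup>2)) * exp (- ((c / \<delta>\<^sup>2) * (snd p)\<^sup>2)) + \<kappa>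
      + b * (fst p) ^ (2 * q) + b * (snd p) ^ (2 * q)" for p
    proof (cases "\<bar>fst p\<bar> \<le> N \<and> \<bar>snd p\<bar> \<le> N")
      case True
      have "\<bar>fst p / \<delta>\<bar> + \<bar>snd p / \<delta>\<bar> \<le> N / \<delta> + N / \<delta>"
        using True \<delta> by (intro add_mono) (auto simp: abs_divide intro: divide_right_mono)
      also have "\<dots> = 2 * (1 / \<delta> * N)" by simp
      also have "\<dots> \<le> 2 * (x / a1) ^ q"
      proof -
        have "N ^ q \<le> (x / a1) ^ q"
          using x a1 N by (intro power_mono) (auto simp: field_simps)
        then show ?thesis using Nq(1) by linarith
      qed
      also have "\<dots> = (2 * (1 / a1) ^ q) * x ^ q" by (simp add: power_divide)
      also have "\<dots> \<le> x * x ^ q" using xX(2) x0 by (intro mult_right_mono) auto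
      finally have "\<bar>fst p / \<delta>\<bar> + \<bar>snd p / \<delta>\<bar> \<le> x ^ r" by (simp add: r_def)
      from X0[OF xX(1) n this]
      have "F p \<le> exp (- ((c / \<delta>\<^sup>2) * (fst p)\<^sup>2)) * exp (- ((c / \<delta>\<^sup>2) * (snd p)\<^sup>2)) + \<kappa>"
        unfolding F_def \<kappa>_def by (simp add: power_divide)
      moreover have "0 \<le> b * (fst p) ^ (2 * q)" "0 \<le> b * (snd p) ^ (2 * q)"
        using b by auto
      ultimately show ?thesis by linarith
    next
      case False
      have "F p \<le> 1" unfolding F_def by (intro prod_le_1) (auto intro: D.cmod_char_le_1)
      moreover have big: "1 \<le> b * z ^ (2 * q)" if "\<not> \<bar>z\<bar> \<le> N" for z
      proof -
        have "N ^ (2 * q) \<le> \<bar>z\<bar> ^ (2 * q)" using that N by (intro power_mono) auto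
        also have "\<bar>z\<bar> ^ (2 * q) = z ^ (2 * q)" by (simp add: power_even_abs)
        finally show ?thesis using N by (simp add: b_def)
      qed
      moreover have "0 \<le> b * z ^ (2 * q)" for z using b by auto
      moreover have "0 \<le> exp (- ((c / \<delta>\<^sup>2) * (fst p)\<^sup>2)) * exp (- ((c / \<delta>\<^sup>2) * (snd p)\<^sup>2))" by simp
      ultimately show ?thesis using False \<kappa>(1) by (smt (verit))
    qed
    have "measure (PiM {1..n} (\<lambda>_. D))
      {\<xi> \<in> space (PiM {1..n} (\<lambda>_. D)). (1 / sqrt N) *\<^sub>R Sn N n x \<xi> \<in> ball a \<delta>}
      \<le> exp (1 / 2) * (\<integral>p. F p \<partial>(std_normal_distribution \<Otimes>\<^sub>M std_normal_distribution))"
      unfolding F_def using N by (intro prob_Sn_ball_le D(1) \<delta>) auto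
    also have "\<dots> \<le> exp (1 / 2) * (pi / (c / \<delta>\<^sup>2) + \<kappa> + 2 * b * m)"
      unfolding m_def using c \<delta> \<kappa> b F_le
      by (intro mult_left_mono integral_std_normal_pair_le) auto
    also have "\<dots> \<le> exp (1 / 2) * (pi / (c / \<delta>\<^sup>2) + \<delta>\<^sup>2 + 2 * \<delta>\<^sup>2 * m)"
      using \<kappa> b m by (intro mult_left_mono add_mono mult_right_mono) auto
    also have "\<dots> = K * \<delta>\<^sup>2" using c \<delta> by (simp add: K_def field_simps)
    finally show ?thesis unfolding \<delta>_def .
  qed
  then show ?thesis by blast
qed

theorem theorem4p2:
  fixes C \<epsilon>g a1 a2 :: real and D :: "real measure"
  assumes "C > 0" and "0 < \<epsilon>g" and "\<epsilon>g < 1/2" and "0 < a1" and "a1 < a2"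
    and "prob_space D" and "sets D = sets borel"
    and "subgaussian D"
    and "integrable D (\<lambda>y. y^2)"
    and "(\<integral>y. y \<partial>D) = 0" and "(\<integral>y. y^2 \<partial>D) = 1"
  shows "\<exists>K N0. \<forall>N n x a. N \<ge> N0 \<and> N \<le> sqrt (real n) \<and> a1 * N \<le> x \<and> x \<le> a2 * N
            \<and> x \<le> sqrt (real n) - N powr \<epsilon>g \<longrightarrow>
          measure (PiM {1..n} (\<lambda>_. D))
            {\<xi> \<in> space (PiM {1..n} (\<lambda>_. D)).
               (1 / sqrt N) *\<^sub>R Sn N n x \<xi> \<in> ball a (N powr (- C))}
          \<le> K * (N powr (- C))^2"
proof -
  interpret prob_space D by fact
  have D: "real_distribution D"
    using assms(6,7) by (intro real_distribution.intro real_distribution_axioms.intro)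
  have meas: "(\<lambda>y. y) \<in> borel_measurable D"
    by (subst measurable_cong_sets[OF assms(7) refl]) simp
  have int: "integrable D (\<lambda>y. y)"
    using assms(9) by (rule square_integrable_imp_integrable[OF meas])
  \<comment> \<open>Variance 1 excludes the point mass at 0.\<close>
  have nz: "\<not> (AE y in D. y = 0)"
  proof
    assume "AE y in D. y = 0"
    then have "AE y in D. y^2 = 0" by eventually_elim simp
    then have "(\<integral>y. y^2 \<partial>D) = (\<integral>y. 0 \<partial>D)"
      using assms(9) by (intro integral_cong_AE) auto
    with assms(11) show False by simp
  qed
  obtain K N0 where K: "\<And>N n x a. N \<ge> N0 \<Longrightarrow> a1 * N \<le> x \<Longrightarrow> x\<^sup>2 \<le> real n \<Longrightarrow>
    measure (PiM {1..n} (\<lambda>_. D))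
      {\<xi> \<in> space (PiM {1..n} (\<lambda>_. D)). (1 / sqrt N) *\<^sub>R Sn N n x \<xi> \<in> ball a (N powr (- C))}
    \<le> K * (N powr (- C))\<^sup>2"
    using small_ball[OF assms(1,4) D int assms(10) nz] by blast
  show ?thesis
  proof (intro exI allI impI, elim conjE)
    fix N x :: real and n a
    \<comment> \<open>The maximum with 0 makes \<open>x\<close> nonnegative, so that
      \<open>x \<le> sqrt n\<close> may be squared.\<close>
    assume N: "max N0 0 \<le> N" and x: "a1 * N \<le> x" "x \<le> sqrt (real n) - N powr \<epsilon>g"
    have "0 \<le> x" using N x(1) assms(4) by (meson max.boundedE mult_nonneg_nonneg less_imp_le order_trans)
    moreover have "x \<le> sqrt (real n)" using x(2) powr_ge_zero[of N \<epsilon>g] by linarith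
    ultimately have "x\<^sup>2 \<le> (sqrt (real n))\<^sup>2" by (intro power_mono)
    then show "measure (PiM {1..n} (\<lambda>_. D))
      {\<xi> \<in> space (PiM {1..n} (\<lambda>_. D)). (1 / sqrt N) *\<^sub>R Sn N n x \<xi> \<in> ball a (N powr (- C))}
      \<le> K * (N powr (- C))^2"
      using K N x(1) by simp
  qed
qed

end
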